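(* For every integer $k\ge1$ there exist constants $c_1,c_2,c_3,c_4>0$ depending only on $k$ such that the following holds. For every $n\ge 1$ and every halfspace $f:\{-1,1\}^n\to\{0,1\}$, $f(x)=\mathbf{1}\left\{\sum_{i}a_ix_i>t\right\}$ (with $a\in\mathbb{R}^n$, $t\in\mathbb{R}$), with $\mathbb{E}[f]\le c_1$ and $I_{\max}(f)\le c_4\,\mathbb{E}[f]$, we have $$c_2\,\mathbb{E}[f]^2\left(\log\frac1{\mathbb{E}[f]}\right)^k\;\le\; W^k(f)\;\le\; c_3\,\mathbb{E}[f]^2\left(\log\frac1{\mathbb{E}[f]}\right)^k .$$
   Context: Expectations and probabilities are with respect to the uniform measure on $\{-1,1\}^n$. The influence of coordinate $i$ on $f$ is $I_i(f)=\Pr_x[f(x)\ne f(x\oplus e_i)]$, where $x\oplus e_i$ is $x$ with the $i$th coordinate flipped, and $I_{\max}(f)=\max_i I_i(f)$. The Fourier coefficients are $\hat f(S)=\mathbb{E}[f(x)\prod_{i\in S}x_i]$ and $W^k(f)=\sum_{|S|=k}\hat f(S)^2$. $\log$ is the natural logarithm. If $\mathbb{E}[f]=0$, the expression $\mathbb{E}[f]^2(\log(1/\mathbb{E}[f]))^k$ is interpreted as $0$. *)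

theory Defs
  imports "HOL-Probability.Probability"
begin

text \<open>
  Coordinates are indexed by \<open>{..<n}\<close>. Points of the cube are extensional functions, so that
  distinct points differ on \<open>{..<n}\<close> and the cube has exactly \<open>2 ^ n\<close> elements. A function on the
  cube is a total function on \<open>nat \<Rightarrow> real\<close>; all notions below depend only on its values on the cube.
\<close>

definition cube :: "nat \<Rightarrow> (nat \<Rightarrow> real) set" where
  "cube n = {..<n} \<rightarrow>\<^sub>E {-1, 1}"

lemma finite_cube: "finite (cube n)"
  unfolding cube_def by (intro finite_PiE) auto

lemma cube_nonempty: "cube n \<noteq> {}"
  unfolding cube_def by (auto simp: PiE_eq_empty_iff)

definition cube_unif :: "nat \<Rightarrow> (nat \<Rightarrow> real) pmf" where
  "cube_unif n = pmf_of_set (cube n)"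

definition cube_expectation :: "nat \<Rightarrow> ((nat \<Rightarrow> real) \<Rightarrow> real) \<Rightarrow> real" where
  "cube_expectation n f = measure_pmf.expectation (cube_unif n) f"

definition flip :: "nat \<Rightarrow> (nat \<Rightarrow> real) \<Rightarrow> (nat \<Rightarrow> real)" where
  "flip i x = x(i := - x i)"

lemma flip_in_cube: "i < n \<Longrightarrow> x \<in> cube n \<Longrightarrow> flip i x \<in> cube n"
  by (auto simp: cube_def flip_def PiE_iff extensional_def)

definition influence :: "nat \<Rightarrow> ((nat \<Rightarrow> real) \<Rightarrow> real) \<Rightarrow> nat \<Rightarrow> real" where
  "influence n f i = measure_pmf.prob (cube_unif n) {x. f x \<noteq> f (flip i x)}"

text \<open>Meaningful only for \<open>n \<ge> 1\<close>, since \<open>Max {}\<close> is unspecified.\<close>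

definition max_influence :: "nat \<Rightarrow> ((nat \<Rightarrow> real) \<Rightarrow> real) \<Rightarrow> real" where
  "max_influence n f = Max (influence n f ` {..<n})"

definition fourier_coeff :: "nat \<Rightarrow> ((nat \<Rightarrow> real) \<Rightarrow> real) \<Rightarrow> nat set \<Rightarrow> real" where
  "fourier_coeff n f S = cube_expectation n (\<lambda>x. f x * (\<Prod>i\<in>S. x i))"

definition fourier_weight :: "nat \<Rightarrow> nat \<Rightarrow> ((nat \<Rightarrow> real) \<Rightarrow> real) \<Rightarrow> real" where
  "fourier_weight k n f = (\<Sum>S | S \<subseteq> {..<n} \<and> card S = k. (fourier_coeff n f S)\<^sup>2)"

definition halfspace :: "nat \<Rightarrow> ((nat \<Rightarrow> real) \<Rightarrow> real) \<Rightarrow> bool" where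
  "halfspace n f \<longleftrightarrow>
     (\<exists>(a :: nat \<Rightarrow> real) (t :: real). \<forall>x\<in>cube n. f x = of_bool ((\<Sum>i<n. a i * x i) > t))"

text \<open>
  The expression \<open>E[f]\<^sup>2 (log (1 / E[f])) ^ k\<close>, with \<open>E[f]\<close> as argument \<open>p\<close>. The convention that it
  is \<open>0\<close> for \<open>p = 0\<close> holds automatically because of the factor \<open>p\<^sup>2\<close>.
\<close>

definition level_bound :: "nat \<Rightarrow> real \<Rightarrow> real" where
  "level_bound k p = p\<^sup>2 * (ln (1 / p)) ^ k"

lemma level_bound_0: "level_bound k 0 = 0"
  by (simp add: level_bound_def)

end

theory Submission
  imports Defs "HOL-Computational_Algebra.Formal_Power_Series"
begin

text \<open>
  Write \<open>p = E[f]\<close> and \<open>\<Lambda> = ln (1 / p)\<close>, and let \<open>a\<close> be the coefficient vector of the halfspace.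

  The upper bound holds for every Boolean function with \<open>p \<le> 1 / e\<close>. Small-set expansion says that
  \<open>\<Sum>S. \<rho> ^ |S| * f^(S)\<^sup>2 \<le> p powr (2 / (1 + \<rho>))\<close> (\<open>stability_le_powr\<close>), where \<open>f^(S)\<close> is the Fourier
  coefficient at \<open>S\<close>. Keeping only the sets of size \<open>k\<close> and taking \<open>\<rho> = 1 / \<Lambda>\<close> gives
  \<open>W\<^sup>k(f) \<le> e\<^sup>2 * p\<^sup>2 * \<Lambda> ^ k\<close>.

  For the lower bound it suffices, by Cauchy-Schwarz, to find a homogeneous multilinear polynomial of
  degree \<open>k\<close> and bounded norm whose correlation with \<open>f\<close> is at least a constant times
  \<open>p * \<Lambda> ^ (k / 2)\<close>. The polynomial is the elementary symmetric polynomial \<open>e\<^sub>k\<close> of the numbers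
  \<open>b i * x i\<close>, for a suitable unit vector \<open>b\<close>. By Newton's identity \<open>e\<^sub>k\<close> agrees with \<open>L ^ k / k!\<close>
  up to terms of lower degree in \<open>L = \<Sum>i<n. b i * x i\<close>, because all higher power sums of the
  \<open>b i * x i\<close> are at most \<open>1\<close> in absolute value (\<open>esym_approx_power\<close>). If \<open>E[L | f = 1] \<ge> s\<close>, then
  \<open>E[|L| ^ k | f = 1] \<ge> s ^ k\<close> by convexity. For odd \<open>k\<close> the negative values of \<open>L\<close> could do harm, but
  \<open>f\<close> is monotone in the direction of \<open>b\<close>, so conditioning on \<open>f = 1\<close> cannot increase \<open>E[exp (- L)]\<close>
  (\<open>monotone_exp_moment\<close>). Hence everything reduces to degree one: a unit vector \<open>b\<close> is needed with
  \<open>E[L | f = 1]\<close> of order \<open>sqrt \<Lambda>\<close>.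

  To find it, scale \<open>a\<close> to a vector \<open>\<alpha>\<close> with \<open>T = \<Sum>i<n. \<alpha> i * tanh (\<alpha> i) = \<Lambda> / 2\<close>. Under the product
  measure with density proportional to \<open>exp (\<Sum>i<n. \<alpha> i * x i)\<close> the linear form \<open>\<Sum>i<n. \<alpha> i * x i\<close> has mean
  \<open>T\<close> and variance at most \<open>T\<close>, so under the uniform measure it exceeds \<open>T / 2\<close> with probability at
  least \<open>exp (- 3 * T / 2) / 2\<close> (\<open>linear_tail_lower_bound\<close>). This is more than \<open>p\<close>; so the rescaled
  threshold is at least \<open>T / 2\<close>, and \<open>E[\<Sum>i<n. \<alpha> i * x i | f = 1] \<ge> T / 2\<close>. If all
  influences are at most \<open>p / 4\<close>, then every \<open>|E[x i | f = 1]|\<close> is at most \<open>1 / 8\<close>, which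
  caps the contribution of the coordinates with \<open>|\<alpha> i| > 1\<close> at \<open>T / 4\<close>. The remaining coordinates therefore contribute at least
  \<open>T / 4\<close>, whereas their squares sum up to at most \<open>2 * T\<close>. Normalising this part of \<open>\<alpha>\<close> yields \<open>b\<close>,
  with \<open>E[L | f = 1] \<ge> sqrt \<Lambda> / 8\<close>.
\<close>

section \<open>Expectations over the discrete cube\<close>

lemma card_cube: "card (cube n) = 2 ^ n"
  by (simp add: cube_def card_PiE numeral_2_eq_2)

lemma cube_expectation_eq_sum: "cube_expectation n f = (\<Sum>x\<in>cube n. f x) / 2 ^ n"
  unfolding cube_expectation_def cube_unif_def
  by (subst integral_pmf_of_set) (simp_all add: finite_cube cube_nonempty card_cube)

lemma cube_expectation_cong:
  "(\<And>x. x \<in> cube n \<Longrightarrow> f x = g x) \<Longrightarrow> cube_expectation n f = cube_expectation n g"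
  by (simp add: cube_expectation_eq_sum)

lemma cube_expectation_mono:
  "(\<And>x. x \<in> cube n \<Longrightarrow> f x \<le> g x) \<Longrightarrow> cube_expectation n f \<le> cube_expectation n g"
  by (auto simp: cube_expectation_eq_sum intro!: divide_right_mono sum_mono)

lemma cube_expectation_nonneg:
  "(\<And>x. x \<in> cube n \<Longrightarrow> 0 \<le> f x) \<Longrightarrow> 0 \<le> cube_expectation n f"
  by (auto simp: cube_expectation_eq_sum intro!: divide_nonneg_pos sum_nonneg)

lemma cube_expectation_add:
  "cube_expectation n (\<lambda>x. f x + g x) = cube_expectation n f + cube_expectation n g"
  by (simp add: cube_expectation_eq_sum sum.distrib add_divide_distrib)

lemma cube_expectation_diff:
  "cube_expectation n (\<lambda>x. f x - g x) = cube_expectation n f - cube_expectation n g"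
  by (simp add: cube_expectation_eq_sum sum_subtractf diff_divide_distrib)

lemma cube_expectation_cmult: "cube_expectation n (\<lambda>x. c * f x) = c * cube_expectation n f"
  by (simp add: cube_expectation_eq_sum sum_distrib_left)

lemma cube_expectation_sum:
  "cube_expectation n (\<lambda>x. \<Sum>i\<in>A. g i x) = (\<Sum>i\<in>A. cube_expectation n (g i))"
  by (simp add: cube_expectation_eq_sum sum_divide_distrib sum.swap[of _ A])

lemma cube_expectation_const: "cube_expectation n (\<lambda>x. c) = c"
  by (simp add: cube_expectation_eq_sum card_cube)

lemma cube_coord: "x \<in> cube n \<Longrightarrow> i < n \<Longrightarrow> x i = 1 \<or> x i = -1"
  by (auto simp: cube_def)

lemma flip_flip: "flip i (flip i x) = x"
  by (simp add: flip_def)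

lemma cube_expectation_flip:
  assumes "i < n"
  shows "cube_expectation n (\<lambda>x. f (flip i x)) = cube_expectation n f"
proof -
  have "(\<Sum>x\<in>cube n. f (flip i x)) = (\<Sum>x\<in>cube n. f x)"
    by (rule sum.reindex_bij_witness[of _ "flip i" "flip i"])
       (auto simp: flip_flip flip_in_cube assms)
  then show ?thesis
    by (simp add: cube_expectation_eq_sum)
qed

lemma cube_expectation_prod:
  "cube_expectation n (\<lambda>x. \<Prod>i<n. g i (x i)) = (\<Prod>i<n. (g i 1 + g i (-1)) / 2)"
proof -
  have "(\<Prod>i<n. g i 1 + g i (-1)) = (\<Prod>i<n. \<Sum>y\<in>{-1, 1}. g i y)"
    by (intro prod.cong) (auto simp: add.commute)
  also have "\<dots> = (\<Sum>x\<in>cube n. \<Prod>i<n. g i (x i))"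
    unfolding cube_def by (rule prod_sum_PiE) auto
  finally show ?thesis
    by (simp add: cube_expectation_eq_sum prod_dividef)
qed

lemma cube_expectation_Suc:
  "cube_expectation (Suc n) f =
     (cube_expectation n (\<lambda>x. f (x(n := 1))) + cube_expectation n (\<lambda>x. f (x(n := -1)))) / 2"
proof -
  have inj: "inj_on (\<lambda>(y, g). g(n := y)) ({-1, 1} \<times> cube n)"
    unfolding cube_def by (rule inj_combinator) auto
  have "cube (Suc n) = (\<lambda>(y, g). g(n := y)) ` ({-1, 1} \<times> cube n)"
    unfolding cube_def lessThan_Suc by (rule PiE_insert_eq)
  then have "(\<Sum>x\<in>cube (Suc n). f x) = (\<Sum>(y, g)\<in>{-1, 1} \<times> cube n. f (g(n := y)))"
    using inj by (simp add: sum.reindex case_prod_unfold)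
  also have "\<dots> = (\<Sum>y\<in>{-1, 1}. \<Sum>x\<in>cube n. f (x(n := y)))"
    by (rule sum.cartesian_product[symmetric])
  finally show ?thesis
    by (simp add: cube_expectation_eq_sum add.commute add_divide_distrib)
qed

section \<open>Small-set expansion and the level inequality\<close>

text \<open>
  Both sides agree to first order at \<open>y = 0\<close>. The second derivative of the right-hand side is
  \<open>q * (q - 1) * ((1 + y) powr (q - 2) + (1 - y) powr (q - 2))\<close>, and the arithmetic-geometric mean
  inequality bounds the last factor below by \<open>2\<close>, since \<open>(1 - y\<^sup>2) powr (q - 2) \<ge> 1\<close>.
\<close>

lemma two_point_powr:
  assumes y: "0 \<le> y" "y \<le> 1" and q: "1 < q" "q \<le> 2"
  shows "2 + q * (q - 1) * y\<^sup>2 \<le> (1 + y) powr q + (1 - y) powr (q :: real)"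
proof -
  define r where "r = q - 1"
  have r: "0 < r" "r \<le> 1" using q by (auto simp: r_def)
  have slope: "2 * r * t \<le> (1 + t) powr r - (1 - t) powr r" if t: "0 \<le> t" "t < 1" for t
  proof -
    let ?g = "\<lambda>t. (1 + t) powr r - (1 - t) powr r - 2 * r * t"
    have "?g 0 \<le> ?g t"
    proof (rule DERIV_nonneg_imp_nondecreasing[OF t(1)])
      fix u assume u: "0 \<le> u" "u \<le> t"
      with t have u1: "u < 1" by simp
      let ?d = "r * (1 + u) powr (r - 1) + r * (1 - u) powr (r - 1) - 2 * r"
      have "(?g has_real_derivative ?d) (at u)"
        using u u1 by (auto intro!: derivative_eq_intros simp: algebra_simps)
      moreover have "0 \<le> ?d"
      proof -
        define A where "A = (1 + u) powr ((r - 1) / 2)"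
        define B where "B = (1 - u) powr ((r - 1) / 2)"
        have "A * B = (1 - u\<^sup>2) powr ((r - 1) / 2)"
          unfolding A_def B_def using u u1
          by (subst powr_mult[symmetric]) (auto simp: algebra_simps power2_eq_square)
        moreover have "1 \<le> (1 - u\<^sup>2) powr ((r - 1) / 2)"
        proof -
          have "0 < 1 - u\<^sup>2" using u u1 by (simp add: power_less_one_iff abs_square_less_1)
          moreover have "1 - u\<^sup>2 \<le> 1" by simp
          ultimately have "(1 - u\<^sup>2) powr 0 \<le> (1 - u\<^sup>2) powr ((r - 1) / 2)"
            using r by (intro powr_mono') auto
          then show ?thesis using \<open>0 < 1 - u\<^sup>2\<close> by simp
        qed
        moreover have "A\<^sup>2 = (1 + u) powr (r - 1)" "B\<^sup>2 = (1 - u) powr (r - 1)"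
          unfolding A_def B_def power2_eq_square by (simp_all add: powr_add[symmetric])
        moreover have "2 * (A * B) \<le> A\<^sup>2 + B\<^sup>2"
          using sum_squares_bound[of A B] by simp
        ultimately have "2 \<le> (1 + u) powr (r - 1) + (1 - u) powr (r - 1)"
          by linarith
        then have "r * 2 \<le> r * ((1 + u) powr (r - 1) + (1 - u) powr (r - 1))"
          using r by (intro mult_left_mono) auto
        then show ?thesis by (simp add: algebra_simps)
      qed
      ultimately show "\<exists>d. (?g has_real_derivative d) (at u) \<and> 0 \<le> d" by blast
    qed
    then show ?thesis by simp
  qed
  let ?h = "\<lambda>t. (1 + t) powr q + (1 - t) powr q - q * (q - 1) * t\<^sup>2"
  show ?thesis
  proof (cases "y = 0")
    case False
    with y have y0: "0 < y" by simp
    have "continuous_on {0..y} ?h"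
      using y q by (intro continuous_intros continuous_on_powr') auto
    moreover have "(?h has_real_derivative
        q * ((1 + t) powr r - (1 - t) powr r - 2 * r * t)) (at t)" if "0 < t" "t < y" for t
      using that y q
      by (auto intro!: derivative_eq_intros simp: algebra_simps r_def)
    ultimately obtain \<xi> where \<xi>: "0 < \<xi>" "\<xi> < y"
      "?h y - ?h 0 = q * ((1 + \<xi>) powr r - (1 - \<xi>) powr r - 2 * r * \<xi>) * (y - 0)"
      using mvt[OF y0, of ?h "\<lambda>t. (*) (q * ((1 + t) powr r - (1 - t) powr r - 2 * r * t))"]
      by (auto simp: has_field_derivative_def)
    moreover have "0 \<le> q * ((1 + \<xi>) powr r - (1 - \<xi>) powr r - 2 * r * \<xi>) * (y - 0)"
      using slope[of \<xi>] \<xi>(1,2) y q by (intro mult_nonneg_nonneg) auto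
    ultimately have "?h 0 \<le> ?h y" by linarith
    then show ?thesis by simp
  qed auto
qed

text \<open>
  Hypercontractivity on a two-point space, from the norm with exponent \<open>1 + \<rho>\<close> to the one with
  exponent \<open>2\<close>, for a nonnegative function with values \<open>w\<close> and \<open>z\<close>. After scaling, \<open>w = 1 + y\<close> and \<open>z = 1 - y\<close>; then
  \<open>two_point_powr\<close> and Bernoulli's inequality with exponent \<open>(1 + \<rho>) / 2 \<le> 1\<close> give the claim.
\<close>

lemma two_point_hypercontractive:
  assumes wz: "0 \<le> w" "0 \<le> z" and \<rho>: "0 < \<rho>" "\<rho> \<le> (1 :: real)"
  shows "((w + z) / 2)\<^sup>2 + \<rho> * ((w - z) / 2)\<^sup>2
           \<le> ((w powr (1 + \<rho>) + z powr (1 + \<rho>)) / 2) powr (2 / (1 + \<rho>))"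
  using wz
proof (induction w z rule: linorder_wlog)
  case (sym a b)
  moreover have "((b - a) / 2)\<^sup>2 = ((a - b) / 2)\<^sup>2"
    by (simp add: power_divide power2_commute)
  ultimately show ?case by (simp add: add.commute)
next
  case (le z w)
  define q where "q = 1 + \<rho>"
  have q: "1 < q" "q \<le> 2" using \<rho> by (auto simp: q_def)
  show ?case
  proof (cases "w = 0")
    case True
    with le show ?thesis by simp
  next
    case False
    with le have w: "0 < w" by simp
    define a where "a = (w + z) / 2"
    define y where "y = (w - z) / (w + z)"
    have a: "0 < a" and y: "0 \<le> y" "y \<le> 1"
      using w le by (auto simp: a_def y_def field_simps)
    have wa: "w = a * (1 + y)" and za: "z = a * (1 - y)" and ay: "(w - z) / 2 = a * y"
      using w le by (auto simp: a_def y_def field_simps)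
    define X where "X = ((1 + y) powr q + (1 - y) powr q) / 2"
    have X: "1 + q / 2 * (\<rho> * y\<^sup>2) \<le> X"
      using two_point_powr[OF y q] by (simp add: X_def q_def)
    have pos: "0 < 1 + \<rho> * y\<^sup>2" using \<rho> by (intro add_pos_nonneg) auto
    have "(1 + \<rho> * y\<^sup>2) powr (q / 2) * 1 powr (1 - q / 2)
        \<le> q / 2 * (1 + \<rho> * y\<^sup>2) + (1 - q / 2) * 1"
      using q pos by (intro Youngs_inequality_0) auto
    also have "\<dots> \<le> X" using X by (simp add: algebra_simps)
    finally have "((1 + \<rho> * y\<^sup>2) powr (q / 2)) powr (2 / q) \<le> X powr (2 / q)"
      using q by (intro powr_mono2) auto
    then have bern: "1 + \<rho> * y\<^sup>2 \<le> X powr (2 / q)"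
      using q pos by (simp add: powr_powr)
    have "((w + z) / 2)\<^sup>2 + \<rho> * ((w - z) / 2)\<^sup>2 = a\<^sup>2 * (1 + \<rho> * y\<^sup>2)"
      unfolding ay a_def[symmetric] by (simp add: algebra_simps power_mult_distrib)
    also have "\<dots> \<le> a\<^sup>2 * X powr (2 / q)"
      using bern by (intro mult_left_mono) auto
    also have "\<dots> = (a powr q * X) powr (2 / q)"
      using a q by (simp add: powr_mult powr_powr)
    also have "a powr q * X = (w powr q + z powr q) / 2"
      unfolding wa za X_def unfolding powr_mult by (simp add: distrib_left)
    also have "((w - z) / 2)\<^sup>2 = ((z - w) / 2)\<^sup>2"
      by (simp add: power_divide power2_commute)
    finally show ?thesis by (simp add: q_def add.commute)
  qed
qed

definition stability :: "nat \<Rightarrow> real \<Rightarrow> ((nat \<Rightarrow> real) \<Rightarrow> real) \<Rightarrow> real" where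
  "stability n \<rho> f = (\<Sum>S\<in>Pow {..<n}. \<rho> ^ card S * (fourier_coeff n f S)\<^sup>2)"

lemma fourier_coeff_Suc:
  fixes f :: "(nat \<Rightarrow> real) \<Rightarrow> real"
  assumes S: "S \<subseteq> {..<n}"
  defines "A \<equiv> fourier_coeff n (\<lambda>x. f (x(n := 1))) S"
    and "B \<equiv> fourier_coeff n (\<lambda>x. f (x(n := -1))) S"
  shows "fourier_coeff (Suc n) f S = (A + B) / 2"
    and "fourier_coeff (Suc n) f (insert n S) = (A - B) / 2"
proof -
  have n: "n \<notin> S" and fin: "finite S"
    using S finite_subset by auto
  have char: "(\<Prod>i\<in>S. (x(n := y)) i) = (\<Prod>i\<in>S. x i)" for x :: "nat \<Rightarrow> real" and y
    using n by (intro prod.cong) auto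
  have char': "(\<Prod>i\<in>insert n S. (x(n := y)) i) = y * (\<Prod>i\<in>S. x i)" for x :: "nat \<Rightarrow> real" and y
    using n fin char[of x y] by simp
  show "fourier_coeff (Suc n) f S = (A + B) / 2"
    unfolding A_def B_def fourier_coeff_def cube_expectation_Suc char by simp
  have "cube_expectation n (\<lambda>x. - g x) = - cube_expectation n g" for g
    using cube_expectation_cmult[of n "-1" g] by simp
  then show "fourier_coeff (Suc n) f (insert n S) = (A - B) / 2"
    unfolding A_def B_def fourier_coeff_def cube_expectation_Suc char' by simp
qed

text \<open>
  Fixing the last coordinate splits \<open>f\<close> into two functions on the smaller cube. The cross term of
  their noisy correlations is controlled by Cauchy-Schwarz, so that only the two numbers \<open>w\<close> and \<open>z\<close>
  remain and the inductive step becomes a two-point problem.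
\<close>

lemma stability_Suc_le:
  assumes \<rho>: "0 \<le> \<rho>" "\<rho> \<le> 1"
    and A: "stability n \<rho> (\<lambda>x. f (x(n := 1))) \<le> w\<^sup>2"
    and B: "stability n \<rho> (\<lambda>x. f (x(n := -1))) \<le> z\<^sup>2"
    and wz: "0 \<le> w" "0 \<le> z"
  shows "stability (Suc n) \<rho> f \<le> ((w + z) / 2)\<^sup>2 + \<rho> * ((w - z) / 2)\<^sup>2"
proof -
  let ?P = "Pow {..<n}"
  let ?A = "fourier_coeff n (\<lambda>x. f (x(n := 1)))"
  let ?B = "fourier_coeff n (\<lambda>x. f (x(n := -1)))"
  let ?c = "\<lambda>S. \<rho> ^ card S * (fourier_coeff (Suc n) f S)\<^sup>2"
  have inj: "inj_on (insert n) ?P"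
    by (auto simp: inj_on_def)
  have ins: "?c (insert n S) = \<rho> * \<rho> ^ card S * (fourier_coeff (Suc n) f (insert n S))\<^sup>2"
    if "S \<in> ?P" for S
  proof -
    have "finite S" "n \<notin> S" using that finite_subset by auto
    then show ?thesis by simp
  qed
  have "stability (Suc n) \<rho> f = sum ?c ?P + sum ?c (insert n ` ?P)"
    unfolding stability_def lessThan_Suc Pow_insert
    by (rule sum.union_disjoint) auto
  also have "sum ?c (insert n ` ?P) =
      (\<Sum>S\<in>?P. \<rho> * \<rho> ^ card S * (fourier_coeff (Suc n) f (insert n S))\<^sup>2)"
    unfolding sum.reindex[OF inj] using ins by (intro sum.cong) auto
  also have "sum ?c ?P + \<dots> =
      (\<Sum>S\<in>?P. \<rho> ^ card S * ((?A S + ?B S) / 2)\<^sup>2 + \<rho> * \<rho> ^ card S * ((?A S - ?B S) / 2)\<^sup>2)"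
    unfolding sum.distrib by (intro arg_cong2[where f = "(+)"] sum.cong) (simp_all add: fourier_coeff_Suc)
  also have "\<dots> = (\<Sum>S\<in>?P. (1 + \<rho>) / 4 * (\<rho> ^ card S * (?A S)\<^sup>2)
      + (1 + \<rho>) / 4 * (\<rho> ^ card S * (?B S)\<^sup>2) + (1 - \<rho>) / 2 * (\<rho> ^ card S * (?A S * ?B S)))"
    by (intro sum.cong) (auto simp: field_simps power2_eq_square)
  also have "\<dots> = (1 + \<rho>) / 4 * stability n \<rho> (\<lambda>x. f (x(n := 1)))
      + (1 + \<rho>) / 4 * stability n \<rho> (\<lambda>x. f (x(n := -1)))
      + (1 - \<rho>) / 2 * (\<Sum>S\<in>?P. \<rho> ^ card S * (?A S * ?B S))"
    by (simp add: sum.distrib sum_distrib_left stability_def)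
  finally have eq: "stability (Suc n) \<rho> f = \<dots>" .
  have "(\<Sum>S\<in>?P. \<rho> ^ card S * (?A S * ?B S))\<^sup>2 =
      (\<Sum>S\<in>?P. (sqrt (\<rho> ^ card S) * ?A S) * (sqrt (\<rho> ^ card S) * ?B S))\<^sup>2"
  proof -
    have "(\<Sum>S\<in>?P. (sqrt (\<rho> ^ card S) * ?A S) * (sqrt (\<rho> ^ card S) * ?B S)) =
      (\<Sum>S\<in>?P. (sqrt (\<rho> ^ card S))\<^sup>2 * (?A S * ?B S))"
      by (intro sum.cong) (auto simp: power2_eq_square)
    then show ?thesis using \<rho> by simp
  qed
  also have "\<dots> \<le> (\<Sum>S\<in>?P. (sqrt (\<rho> ^ card S) * ?A S)\<^sup>2) * (\<Sum>S\<in>?P. (sqrt (\<rho> ^ card S) * ?B S)\<^sup>2)"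
    by (rule Cauchy_Schwarz_ineq_sum)
  also have "\<dots> = stability n \<rho> (\<lambda>x. f (x(n := 1))) * stability n \<rho> (\<lambda>x. f (x(n := -1)))"
    using \<rho> by (simp add: stability_def power_mult_distrib)
  also have "\<dots> \<le> w\<^sup>2 * z\<^sup>2"
    using A B \<rho> by (intro mult_mono) (auto simp: stability_def intro!: sum_nonneg)
  also have "\<dots> = (w * z)\<^sup>2" by (simp add: power_mult_distrib)
  finally have cross: "(\<Sum>S\<in>?P. \<rho> ^ card S * (?A S * ?B S)) \<le> w * z"
    using wz by (meson abs_le_square_iff abs_le_D1 mult_nonneg_nonneg power2_le_imp_le)
  have "stability (Suc n) \<rho> f \<le> (1 + \<rho>) / 4 * w\<^sup>2 + (1 + \<rho>) / 4 * z\<^sup>2 + (1 - \<rho>) / 2 * (w * z)"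
    unfolding eq using A B cross \<rho> by (intro add_mono mult_left_mono) auto
  then show ?thesis by (simp add: field_simps power2_eq_square)
qed

text \<open>
  Small-set expansion. A Boolean function satisfies \<open>E[f powr (1 + \<rho>)] = E[f]\<close>, and so do its
  restrictions; the induction can therefore be run on the means alone.
\<close>

theorem stability_le_powr:
  assumes \<rho>: "0 < \<rho>" "\<rho> \<le> 1" and f: "\<And>x. x \<in> cube n \<Longrightarrow> f x \<in> {0, 1}"
  shows "stability n \<rho> f \<le> cube_expectation n f powr (2 / (1 + \<rho>))"
  using f
proof (induction n arbitrary: f)
  case 0
  have "cube 0 = {\<lambda>_. undefined}" by (simp add: cube_def)
  with "0.prems" show ?case
    by (auto simp: stability_def fourier_coeff_def cube_expectation_eq_sum)
next
  case (Suc n)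
  have mem: "x(n := y) \<in> cube (Suc n)" if "x \<in> cube n" "y \<in> {-1, 1}" for x y
    using that unfolding cube_def lessThan_Suc by (intro PiE_fun_upd) auto
  let ?A = "\<lambda>x. f (x(n := 1))" and ?B = "\<lambda>x. f (x(n := -1))"
  have fA: "?A x \<in> {0, 1}" and fB: "?B x \<in> {0, 1}" if "x \<in> cube n" for x
    using Suc.prems mem[OF that] by blast+
  let ?u = "cube_expectation n ?A" and ?v = "cube_expectation n ?B"
  have uv: "0 \<le> ?u" "0 \<le> ?v"
    using fA fB by (fastforce intro!: cube_expectation_nonneg)+
  define w where "w = ?u powr (1 / (1 + \<rho>))"
  define z where "z = ?v powr (1 / (1 + \<rho>))"
  have wz: "0 \<le> w" "0 \<le> z" by (auto simp: w_def z_def)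
  have sq: "w\<^sup>2 = ?u powr (2 / (1 + \<rho>))" "z\<^sup>2 = ?v powr (2 / (1 + \<rho>))"
    by (simp_all add: w_def z_def power2_eq_square powr_add[symmetric])
  have pw: "w powr (1 + \<rho>) = ?u" "z powr (1 + \<rho>) = ?v"
    using uv \<rho> by (simp_all add: w_def z_def powr_powr)
  have "stability (Suc n) \<rho> f \<le> ((w + z) / 2)\<^sup>2 + \<rho> * ((w - z) / 2)\<^sup>2"
    using Suc.IH[of ?A] Suc.IH[of ?B] fA fB \<rho> wz unfolding sq[symmetric]
    by (intro stability_Suc_le) auto
  also have "\<dots> \<le> ((?u + ?v) / 2) powr (2 / (1 + \<rho>))"
    using two_point_hypercontractive[OF wz \<rho>] by (simp add: pw)
  finally show ?case by (simp add: cube_expectation_Suc)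
qed

text \<open>
  With \<open>\<rho> = 1 / \<Lambda>\<close>, where \<open>\<Lambda> = ln (1 / p)\<close>, the exponent satisfies \<open>2 / (1 + \<rho>) \<ge> 2 - 2 * \<rho>\<close>, and
  \<open>p powr (- 2 * \<rho>) = exp 2\<close>; so the smallness of \<open>\<rho>\<close> costs only a constant factor.
\<close>

theorem level_inequality:
  assumes f: "\<And>x. x \<in> cube n \<Longrightarrow> f x \<in> {0, 1}" and p: "cube_expectation n f \<le> exp (-1)"
  shows "fourier_weight k n f \<le> exp 2 * level_bound k (cube_expectation n f)"
proof -
  define p where "p = cube_expectation n f"
  have p0: "0 \<le> p"
    using f unfolding p_def by (fastforce intro!: cube_expectation_nonneg)
  have weight: "\<rho> ^ k * fourier_weight k n f \<le> p powr (2 / (1 + \<rho>))" if \<rho>: "0 < \<rho>" "\<rho> \<le> 1" for \<rho>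
  proof -
    have "\<rho> ^ k * fourier_weight k n f =
        (\<Sum>S | S \<subseteq> {..<n} \<and> card S = k. \<rho> ^ card S * (fourier_coeff n f S)\<^sup>2)"
      unfolding fourier_weight_def sum_distrib_left by (intro sum.cong) auto
    also have "\<dots> \<le> stability n \<rho> f"
      unfolding stability_def using \<rho> by (intro sum_mono2) auto
    also have "\<dots> \<le> p powr (2 / (1 + \<rho>))"
      unfolding p_def using \<rho> f by (rule stability_le_powr)
    finally show ?thesis .
  qed
  show ?thesis
  proof (cases "p = 0")
    case True
    with weight[of 1] show ?thesis by (simp add: p_def[symmetric] level_bound_0)
  next
    case False
    with p0 have pp: "0 < p" by simp
    define \<Lambda> where "\<Lambda> = ln (1 / p)"
    have \<Lambda>: "1 \<le> \<Lambda>"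
    proof -
      have "ln p \<le> ln (exp (-1))" using pp p p_def by (subst ln_le_cancel_iff) auto
      then show ?thesis using pp by (simp add: \<Lambda>_def ln_div)
    qed
    have "(1 / \<Lambda>) ^ k * fourier_weight k n f \<le> p powr (2 / (1 + 1 / \<Lambda>))"
      using \<Lambda> by (intro weight) auto
    also have "\<dots> = exp (- \<Lambda> * (2 / (1 + 1 / \<Lambda>)))"
      using pp by (simp add: powr_def \<Lambda>_def ln_div)
    also have "\<dots> \<le> exp (2 - 2 * \<Lambda>)"
      using \<Lambda> by (simp add: field_simps)
    also have "\<dots> = exp 2 * p\<^sup>2"
    proof -
      have "exp (- (2 * \<Lambda>)) = (exp (- \<Lambda>))\<^sup>2" by (simp add: exp_double[symmetric])
      also have "exp (- \<Lambda>) = p" using pp by (simp add: \<Lambda>_def ln_div)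
      finally show ?thesis by (simp add: exp_diff exp_minus divide_inverse)
    qed
    finally have "fourier_weight k n f \<le> exp 2 * p\<^sup>2 * \<Lambda> ^ k"
      using \<Lambda> by (simp add: field_simps)
    then show ?thesis by (simp add: level_bound_def p_def[symmetric] \<Lambda>_def mult.assoc)
  qed
qed

section \<open>Lower tails of linear forms by exponential tilting\<close>

lemma mult_tanh_abs: "\<bar>u\<bar> * tanh \<bar>u\<bar> = u * tanh (u :: real)"
  by (auto simp: abs_if)

lemma mult_tanh_nonneg: "0 \<le> u * tanh (u :: real)"
  unfolding mult_tanh_abs[symmetric, of u] by (intro mult_nonneg_nonneg) (auto simp del: tanh_real_abs)

lemma sinh_ge_self: "0 \<le> u \<Longrightarrow> u \<le> sinh (u :: real)"
  using real_le_x_sinh[of u] by (simp add: sinh_def exp_minus)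

text \<open>
  A sign biased to have mean \<open>tanh u\<close> has variance \<open>1 - (tanh u)\<^sup>2\<close>. Thus, after multiplication by \<open>u\<close>,
  its variance is at most its mean, because \<open>u \<le> sinh u * cosh u\<close> for \<open>u \<ge> 0\<close>.
\<close>

lemma tilted_variance_le_mean: "u\<^sup>2 * (1 - (tanh u)\<^sup>2) \<le> u * tanh (u :: real)"
proof -
  have *: "u\<^sup>2 * (1 - (tanh u)\<^sup>2) \<le> u * tanh u" if u: "0 \<le> u" for u :: real
  proof -
    have "u * 1 \<le> sinh u * cosh u"
      using u sinh_ge_self[OF u] by (intro mult_mono) (auto simp: cosh_real_ge_1)
    then have "u\<^sup>2 \<le> u * (sinh u * cosh u)"
      using u by (simp add: power2_eq_square mult_left_mono)
    then have "u\<^sup>2 / (cosh u)\<^sup>2 \<le> u * (sinh u * cosh u) / (cosh u)\<^sup>2"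
      by (intro divide_right_mono) auto
    moreover have "1 - (tanh u)\<^sup>2 = ((cosh u)\<^sup>2 - (sinh u)\<^sup>2) / (cosh u)\<^sup>2"
      by (simp add: tanh_def power_divide diff_divide_distrib)
    moreover have "u * (sinh u * cosh u) / (cosh u)\<^sup>2 = u * tanh u"
      by (simp add: tanh_def power2_eq_square)
    ultimately show ?thesis by (simp add: hyperbolic_pythagoras)
  qed
  from *[of "\<bar>u\<bar>"] show ?thesis by (simp add: mult_tanh_abs del: tanh_real_abs) (simp add: mult_tanh_abs)
qed

text \<open>
  The even function \<open>u * tanh u\<close> behaves like \<open>u\<^sup>2\<close> near \<open>0\<close> and like \<open>|u|\<close> far away. The next two lemmas
  are the one-sided versions of this for light and for heavy coordinates.
\<close>

lemma square_le_mult_tanh: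
  assumes "\<bar>u\<bar> \<le> (1 :: real)"
  shows "u\<^sup>2 \<le> 2 * (u * tanh u)"
proof -
  define v where "v = \<bar>u\<bar>"
  have v: "0 \<le> v" "v \<le> 1" using assms by (auto simp: v_def)
  have "exp v \<le> exp 1" using v by simp
  moreover have "exp (- v) \<le> 1" using v by simp
  ultimately have "exp v + exp (- v) \<le> 4" using exp_le by linarith
  then have c: "cosh v \<le> 2" by (simp add: cosh_def)
  have "v * cosh v \<le> v * 2" using v c by (intro mult_left_mono) auto
  also have "\<dots> \<le> 2 * sinh v" using sinh_ge_self[OF v(1)] by simp
  finally have "v \<le> 2 * tanh v" by (simp add: tanh_def field_simps)
  then have "v * v \<le> v * (2 * tanh v)" using v by (intro mult_left_mono) auto
  then show ?thesis using mult_tanh_abs[of u] by (simp add: v_def power2_eq_square del: tanh_real_abs)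
qed

lemma abs_le_mult_tanh:
  assumes "1 < \<bar>u :: real\<bar>"
  shows "\<bar>u\<bar> \<le> 2 * (u * tanh u)"
proof -
  have "1 \<le> 2 * tanh (1 :: real)" using square_le_mult_tanh[of 1] by simp
  also have "\<dots> \<le> 2 * tanh \<bar>u\<bar>" using assms by (simp del: tanh_real_abs)
  finally have "\<bar>u\<bar> * 1 \<le> \<bar>u\<bar> * (2 * tanh \<bar>u\<bar>)" by (intro mult_left_mono) auto
  then show ?thesis using mult_tanh_abs[of u] by (simp del: tanh_real_abs)
qed

text \<open>
  The density, with respect to the uniform measure, of the product measure under which coordinate \<open>i\<close>
  has mean \<open>tanh (\<alpha> i)\<close>. It equals \<open>exp (\<Sum>i<n. \<alpha> i * x i)\<close> divided by the product of the
  \<open>cosh (\<alpha> i)\<close>, and so is bounded by the exponential alone.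
\<close>

definition tilt :: "nat \<Rightarrow> (nat \<Rightarrow> real) \<Rightarrow> (nat \<Rightarrow> real) \<Rightarrow> real" where
  "tilt n \<alpha> x = (\<Prod>i<n. 1 + tanh (\<alpha> i) * x i)"

lemma tilt_factor:
  assumes "y = 1 \<or> y = (-1 :: real)"
  shows "1 + tanh a * y = exp (a * y) / cosh a"
proof -
  have "1 + tanh a * y = (cosh a + sinh a * y) / cosh a"
    by (simp add: tanh_def field_simps)
  also have "cosh a + sinh a * y = exp (a * y)"
    using assms cosh_plus_sinh[of a] cosh_minus_sinh[of a] by auto
  finally show ?thesis .
qed

lemma tilt_nonneg: "x \<in> cube n \<Longrightarrow> 0 \<le> tilt n \<alpha> x"
  unfolding tilt_def by (intro prod_nonneg) (auto simp: tilt_factor cube_coord)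

lemma tilt_le_exp:
  assumes x: "x \<in> cube n"
  shows "tilt n \<alpha> x \<le> exp (\<Sum>i<n. \<alpha> i * x i)"
proof -
  have "tilt n \<alpha> x = (\<Prod>i<n. exp (\<alpha> i * x i) / cosh (\<alpha> i))"
    unfolding tilt_def using x by (intro prod.cong) (auto simp: tilt_factor cube_coord)
  also have "\<dots> \<le> (\<Prod>i<n. exp (\<alpha> i * x i))"
    by (intro prod_mono) (auto simp: divide_le_eq cosh_real_ge_1 mult_le_cancel_left1)
  also have "\<dots> = exp (\<Sum>i<n. \<alpha> i * x i)"
    by (simp add: exp_sum)
  finally show ?thesis .
qed

lemma tilt_expectation: "cube_expectation n (tilt n \<alpha>) = 1"
  unfolding tilt_def by (subst cube_expectation_prod) simp

lemma tilt_covariance: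
  assumes "i < n" "j < n"
  shows "cube_expectation n (\<lambda>x. (x i - tanh (\<alpha> i)) * (x j - tanh (\<alpha> j)) * tilt n \<alpha> x)
           = (if i = j then 1 - (tanh (\<alpha> i))\<^sup>2 else 0)"
proof -
  let ?g = "\<lambda>l y. (1 + tanh (\<alpha> l) * y) * (if l = i then y - tanh (\<alpha> l) else 1)
      * (if l = j then y - tanh (\<alpha> l) else 1)"
  have "(x i - tanh (\<alpha> i)) * (x j - tanh (\<alpha> j)) * tilt n \<alpha> x = (\<Prod>l<n. ?g l (x l))" for x
    using assms by (simp add: prod.distrib tilt_def)
  then have eq: "cube_expectation n (\<lambda>x. (x i - tanh (\<alpha> i)) * (x j - tanh (\<alpha> j)) * tilt n \<alpha> x)
      = (\<Prod>l<n. (?g l 1 + ?g l (-1)) / 2)"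
    using cube_expectation_prod[of n ?g] by presburger
  show ?thesis
  proof (cases "i = j")
    case True
    have "(\<Prod>l<n. (?g l 1 + ?g l (-1)) / 2) = (\<Prod>l<n. if l = i then 1 - (tanh (\<alpha> l))\<^sup>2 else 1)"
      using True by (intro prod.cong) (auto simp: field_simps power2_eq_square)
    then show ?thesis using True assms eq by simp
  next
    case False
    have "(?g i 1 + ?g i (-1)) / 2 = 0" using False by (auto simp: field_simps)
    then have "(\<Prod>l<n. (?g l 1 + ?g l (-1)) / 2) = 0"
      using assms by (intro prod_zero) (auto intro!: bexI[of _ i])
    then show ?thesis using False eq by simp
  qed
qed

lemma tilt_variance:
  "cube_expectation n (\<lambda>x. ((\<Sum>i<n. \<alpha> i * x i) - (\<Sum>i<n. \<alpha> i * tanh (\<alpha> i)))\<^sup>2 * tilt n \<alpha> x)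
     \<le> (\<Sum>i<n. \<alpha> i * tanh (\<alpha> i))"
proof -
  let ?t = "\<lambda>i. tanh (\<alpha> i)"
  have "((\<Sum>i<n. \<alpha> i * x i) - (\<Sum>i<n. \<alpha> i * ?t i))\<^sup>2 * tilt n \<alpha> x
      = (\<Sum>i<n. \<Sum>j<n. \<alpha> i * \<alpha> j * ((x i - ?t i) * (x j - ?t j) * tilt n \<alpha> x))" for x
  proof -
    have eq: "(\<Sum>i<n. \<alpha> i * x i) - (\<Sum>i<n. \<alpha> i * ?t i) = (\<Sum>i<n. \<alpha> i * (x i - ?t i))"
      by (simp add: sum_subtractf algebra_simps)
    show ?thesis
      unfolding eq power2_eq_square sum_product unfolding sum_distrib_right by (intro sum.cong refl) (simp only: mult_ac)
  qed
  then have "cube_expectation n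
        (\<lambda>x. ((\<Sum>i<n. \<alpha> i * x i) - (\<Sum>i<n. \<alpha> i * ?t i))\<^sup>2 * tilt n \<alpha> x)
      = (\<Sum>i<n. \<Sum>j<n. \<alpha> i * \<alpha> j * (if i = j then 1 - (?t i)\<^sup>2 else 0))"
    by (simp only: cube_expectation_sum cube_expectation_cmult, intro sum.cong refl)
       (simp add: tilt_covariance)
  also have "\<dots> = (\<Sum>i<n. (\<alpha> i)\<^sup>2 * (1 - (?t i)\<^sup>2))"
    by (simp add: if_distrib[where f = "\<lambda>y. _ * y"] power2_eq_square cong: if_cong)
  also have "\<dots> \<le> (\<Sum>i<n. \<alpha> i * ?t i)"
    by (intro sum_mono tilted_variance_le_mean)
  finally show ?thesis .
qed

text \<open>
  Under the tilted measure the linear form has mean \<open>T\<close> and variance at most \<open>T\<close>; by Chebyshev it lies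
  between \<open>T / 2\<close> and \<open>3 * T / 2\<close> with probability at least \<open>1 - 4 / T \<ge> 1 / 2\<close>. On this event the density
  is at most \<open>exp (3 * T / 2)\<close>, which transfers the estimate to the uniform measure.
\<close>

lemma linear_tail_lower_bound:
  fixes \<alpha> :: "nat \<Rightarrow> real" and n :: nat
  defines "T \<equiv> \<Sum>i<n. \<alpha> i * tanh (\<alpha> i)"
  assumes T: "8 \<le> T"
  shows "exp (- (3 / 2) * T) / 2 \<le> cube_expectation n (\<lambda>x. of_bool (T / 2 \<le> (\<Sum>i<n. \<alpha> i * x i)))"
proof -
  let ?l = "\<lambda>x. \<Sum>i<n. \<alpha> i * x i"
  let ?P = "cube_expectation n (\<lambda>x. of_bool (T / 2 \<le> ?l x))"
  have point: "tilt n \<alpha> x - 4 / T\<^sup>2 * ((?l x - T)\<^sup>2 * tilt n \<alpha> x)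
      \<le> exp (3 / 2 * T) * of_bool (T / 2 \<le> ?l x)" if x: "x \<in> cube n" for x
  proof (cases "\<bar>?l x - T\<bar> \<le> T / 2")
    case True
    then have l: "T / 2 \<le> ?l x" "?l x \<le> 3 / 2 * T" by linarith+
    have "tilt n \<alpha> x - 4 / T\<^sup>2 * ((?l x - T)\<^sup>2 * tilt n \<alpha> x) \<le> tilt n \<alpha> x"
      using tilt_nonneg[OF x] by simp
    also have "\<dots> \<le> exp (?l x)" by (rule tilt_le_exp[OF x])
    also have "\<dots> \<le> exp (3 / 2 * T)" using l by simp
    finally show ?thesis using l by simp
  next
    case False
    then have "(T / 2)\<^sup>2 \<le> (?l x - T)\<^sup>2"
      using T by (intro abs_le_square_iff[THEN iffD1]) auto
    then have "1 \<le> 4 / T\<^sup>2 * (?l x - T)\<^sup>2"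
      using T by (simp add: field_simps power2_eq_square)
    then have "1 * tilt n \<alpha> x \<le> 4 / T\<^sup>2 * (?l x - T)\<^sup>2 * tilt n \<alpha> x"
      using tilt_nonneg[OF x] by (rule mult_right_mono)
    then have "tilt n \<alpha> x - 4 / T\<^sup>2 * ((?l x - T)\<^sup>2 * tilt n \<alpha> x) \<le> 0"
      by (simp only: mult_1 mult.assoc diff_le_0_iff_le)
    also have "0 \<le> exp (3 / 2 * T) * of_bool (T / 2 \<le> ?l x)" by simp
    finally show ?thesis .
  qed
  have "1 - 4 / T\<^sup>2 * T
      \<le> 1 - 4 / T\<^sup>2 * cube_expectation n (\<lambda>x. (?l x - T)\<^sup>2 * tilt n \<alpha> x)"
    using tilt_variance[of n \<alpha>] T unfolding T_def[symmetric] by (intro diff_left_mono mult_left_mono) auto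
  also have "\<dots> = cube_expectation n (\<lambda>x. tilt n \<alpha> x - 4 / T\<^sup>2 * ((?l x - T)\<^sup>2 * tilt n \<alpha> x))"
    by (simp only: cube_expectation_diff cube_expectation_cmult tilt_expectation)
  also have "\<dots> \<le> cube_expectation n (\<lambda>x. exp (3 / 2 * T) * of_bool (T / 2 \<le> ?l x))"
    by (intro cube_expectation_mono point)
  also have "\<dots> = exp (3 / 2 * T) * ?P" by (rule cube_expectation_cmult)
  finally have "1 - 4 / T\<^sup>2 * T \<le> exp (3 / 2 * T) * ?P" .
  moreover have "4 / T\<^sup>2 * T = 4 / T" using T by (simp add: power2_eq_square)
  moreover have "1 / 2 \<le> 1 - 4 / T" using T by (simp add: field_simps)
  ultimately have "1 / 2 \<le> exp (3 / 2 * T) * ?P" by linarith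
  then have "exp (- (3 / 2 * T)) * (1 / 2) \<le> exp (- (3 / 2 * T)) * (exp (3 / 2 * T) * ?P)"
    by (intro mult_left_mono) auto
  also have "\<dots> = ?P" by (simp add: mult.assoc[symmetric] exp_add[symmetric])
  finally show ?thesis by simp
qed

text \<open>
  The sum is continuous in \<open>s\<close> and vanishes at \<open>s = 0\<close>; a single nonzero coefficient already makes it
  unbounded.
\<close>

lemma exists_tilt_scale:
  fixes a :: "nat \<Rightarrow> real"
  assumes i: "i < n" "a i \<noteq> 0" and T: "0 < T"
  obtains s where "0 < s" "(\<Sum>i<n. s * a i * tanh (s * a i)) = T"
proof -
  let ?h = "\<lambda>s. \<Sum>i<n. s * a i * tanh (s * a i)"
  define u where "u = 1 + T / tanh 1"
  define S where "S = u / \<bar>a i\<bar>"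
  have t1: "0 < tanh (1 :: real)" by simp
  have u: "1 \<le> u" using T t1 by (simp add: u_def)
  have S: "0 < S" using i u by (simp add: S_def)
  have "T \<le> u * tanh 1" using t1 by (simp add: u_def field_simps)
  also have "\<dots> \<le> u * tanh u" using u by (intro mult_left_mono) auto
  also have "u = \<bar>S * a i\<bar>" using i u by (simp add: S_def abs_mult)
  also have "\<bar>S * a i\<bar> * tanh \<bar>S * a i\<bar> = S * a i * tanh (S * a i)" by (rule mult_tanh_abs)
  also have "\<dots> \<le> ?h S"
    using i by (intro member_le_sum[where f = "\<lambda>i. S * a i * tanh (S * a i)"]) (auto intro: mult_tanh_nonneg)
  finally have "T \<le> ?h S" .
  moreover have "?h 0 \<le> T" using T by simp
  moreover have "continuous_on {0..S} ?h"
    by (intro continuous_intros) auto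
  ultimately obtain s where s: "0 \<le> s" "?h s = T"
    using IVT'[of ?h 0 T S] S by auto
  with T have "s \<noteq> 0" by auto
  with s show ?thesis by (intro that[of s]) auto
qed

section \<open>Elementary symmetric polynomials and powers of a linear form\<close>

definition esym :: "nat \<Rightarrow> nat \<Rightarrow> (nat \<Rightarrow> real) \<Rightarrow> real" where
  "esym n k z = (\<Sum>S | S \<subseteq> {..<n} \<and> card S = k. \<Prod>i\<in>S. z i)"

definition esym_gf :: "nat \<Rightarrow> (nat \<Rightarrow> real) \<Rightarrow> real fps" where
  "esym_gf n z = (\<Prod>i<n. 1 + fps_const (z i) * fps_X)"

lemma fps_const_prod: "fps_const (\<Prod>i\<in>S. z i) = (\<Prod>i\<in>S. fps_const (z i :: real))"
  by (induction S rule: infinite_finite_induct) (simp_all flip: fps_const_mult)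

lemma esym_gf_nth: "fps_nth (esym_gf n z) k = esym n k z"
proof -
  have "esym_gf n z = (\<Prod>i<n. fps_const (z i) * fps_X + 1)"
    by (simp add: esym_gf_def add.commute)
  also have "\<dots> = (\<Sum>S\<in>Pow {..<n}. (\<Prod>i\<in>S. fps_const (z i) * fps_X) * (\<Prod>i\<in>{..<n} - S. 1))"
    by (rule prod_add) simp
  also have "\<dots> = (\<Sum>S\<in>Pow {..<n}. fps_const (\<Prod>i\<in>S. z i) * fps_X ^ card S)"
    by (simp add: prod.distrib fps_const_prod)
  finally have "fps_nth (esym_gf n z) k = (\<Sum>S\<in>Pow {..<n}. if card S = k then \<Prod>i\<in>S. z i else 0)"
    by (simp add: fps_sum_nth fps_X_power_nth if_distrib eq_commute cong: if_cong)
  also have "\<dots> = (\<Sum>S\<in>{S \<in> Pow {..<n}. card S = k}. \<Prod>i\<in>S. z i)"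
    by (rule sum.inter_filter[symmetric]) simp
  finally show ?thesis by (simp add: esym_def)
qed

lemma esym_0: "esym n 0 z = 1"
proof -
  have "{S. S \<subseteq> {..<n} \<and> card S = 0} = {{}}"
    using finite_subset[of _ "{..<n}"] by auto
  then show ?thesis by (simp add: esym_def)
qed

definition power_sum_gf :: "nat \<Rightarrow> (nat \<Rightarrow> real) \<Rightarrow> real fps" where
  "power_sum_gf n z = (\<Sum>i<n. Abs_fps (\<lambda>j. z i * (- z i) ^ j))"

lemma power_sum_gf_nth: "fps_nth (power_sum_gf n z) j = (\<Sum>i<n. z i * (- z i) ^ j)"
  by (simp add: power_sum_gf_def fps_sum_nth)

lemma geometric_fps: "(1 + fps_const c * fps_X) * Abs_fps (\<lambda>j. c * (- c) ^ j) = fps_const (c :: real)"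
proof (rule fps_ext)
  fix j
  show "fps_nth ((1 + fps_const c * fps_X) * Abs_fps (\<lambda>j. c * (- c) ^ j)) j = fps_nth (fps_const c) j"
    by (cases j) (simp_all add: distrib_right mult.assoc)
qed

text \<open>
  The logarithmic derivative of \<open>\<Prod>i<n. 1 + z i * X\<close> is \<open>\<Sum>i<n. z i / (1 + z i * X)\<close>, which is the generating
  function of the signed power sums. Comparing coefficients gives Newton's identity.
\<close>

lemma fps_deriv_esym_gf: "fps_deriv (esym_gf n z) = esym_gf n z * power_sum_gf n z"
proof (induction n)
  case 0
  show ?case by (simp add: esym_gf_def power_sum_gf_def)
next
  case (Suc n)
  let ?F = "1 + fps_const (z n) * fps_X" and ?G = "Abs_fps (\<lambda>j. z n * (- z n) ^ j)"
  have F: "esym_gf (Suc n) z = esym_gf n z * ?F" "power_sum_gf (Suc n) z = power_sum_gf n z + ?G"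
    by (simp_all add: esym_gf_def power_sum_gf_def)
  have "fps_deriv (esym_gf (Suc n) z) = esym_gf n z * power_sum_gf n z * ?F + esym_gf n z * fps_const (z n)"
    unfolding F by (simp add: Suc.IH)
  also have "\<dots> = esym_gf n z * ?F * power_sum_gf n z + esym_gf n z * (?F * ?G)"
    unfolding geometric_fps by (simp only: mult_ac)
  also have "\<dots> = esym_gf (Suc n) z * power_sum_gf (Suc n) z"
    unfolding F by (simp only: distrib_left distrib_right mult_1_left mult_1_right mult_ac add_ac)
  finally show ?case .
qed

theorem newton_identity:
  "real (Suc k) * esym n (Suc k) z = (\<Sum>j\<le>k. (\<Sum>i<n. z i * (- z i) ^ j) * esym n (k - j) z)"
proof -
  have "real (Suc k) * esym n (Suc k) z = fps_nth (fps_deriv (esym_gf n z)) k"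
    by (simp add: esym_gf_nth)
  also have "\<dots> = fps_nth (power_sum_gf n z * esym_gf n z) k"
    by (simp add: fps_deriv_esym_gf mult.commute)
  also have "\<dots> = (\<Sum>j\<le>k. fps_nth (power_sum_gf n z) j * fps_nth (esym_gf n z) (k - j))"
    by (simp add: fps_mult_nth atLeast0AtMost)
  finally show ?thesis by (simp add: power_sum_gf_nth esym_gf_nth)
qed

text \<open>
  With \<open>\<Sum>i<n. (z i)\<^sup>2 \<le> 1\<close> each \<open>|z i|\<close> is at most \<open>1\<close>, so every power sum of order at least two is dominated by
  the sum of squares. Only the power sum of order one can be large.
\<close>

lemma abs_higher_power_sum_le:
  fixes z :: "nat \<Rightarrow> real"
  assumes z: "(\<Sum>i<n. (z i)\<^sup>2) \<le> 1" and j: "1 \<le> j"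
  shows "\<bar>\<Sum>i<n. z i * (- z i) ^ j\<bar> \<le> (1 :: real)"
proof -
  have "\<bar>\<Sum>i<n. z i * (- z i) ^ j\<bar> \<le> (\<Sum>i<n. \<bar>z i * (- z i) ^ j\<bar>)" by (rule sum_abs)
  also have "\<dots> \<le> (\<Sum>i<n. (z i)\<^sup>2)"
  proof (rule sum_mono)
    fix i assume i: "i \<in> {..<n}"
    have "(z i)\<^sup>2 \<le> (\<Sum>i<n. (z i)\<^sup>2)" using i by (intro member_le_sum) auto
    with z have "\<bar>z i\<bar> \<le> 1" by (simp add: abs_square_le_1[symmetric])
    then have "\<bar>z i\<bar> ^ (Suc j) \<le> \<bar>z i\<bar> ^ 2" using j by (intro power_decreasing) auto
    then show "\<bar>z i * (- z i) ^ j\<bar> \<le> (z i)\<^sup>2" by (simp add: abs_mult power_abs)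
  qed
  finally show ?thesis using z by simp
qed

lemma abs_esym_le_power:
  assumes z: "(\<Sum>i<n. (z i)\<^sup>2) \<le> 1"
  shows "\<bar>esym n k z\<bar> \<le> (1 + \<bar>\<Sum>i<n. z i\<bar>) ^ k"
proof (induction k rule: less_induct)
  case (less k)
  define y where "y = 1 + \<bar>\<Sum>i<n. z i\<bar>"
  have y: "1 \<le> y" by (simp add: y_def)
  show ?case
  proof (cases k)
    case 0
    then show ?thesis by (simp add: esym_0)
  next
    case (Suc m)
    have IH: "\<bar>esym n j z\<bar> \<le> y ^ m" if "j \<le> m" for j
      using less.IH[of j] that Suc power_increasing[OF that y] by (simp add: y_def)
    have "\<bar>real (Suc m) * esym n (Suc m) z\<bar>
        \<le> (\<Sum>j\<le>m. \<bar>(\<Sum>i<n. z i * (- z i) ^ j) * esym n (m - j) z\<bar>)"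
      unfolding newton_identity by (rule sum_abs)
    also have "\<dots> \<le> (\<Sum>j\<le>m. y * y ^ m)"
    proof (rule sum_mono)
      fix j assume "j \<in> {..m}"
      have "\<bar>\<Sum>i<n. z i * (- z i) ^ j\<bar> \<le> y"
        using abs_higher_power_sum_le[OF z, of j] by (cases "j = 0") (auto simp: y_def)
      then show "\<bar>(\<Sum>i<n. z i * (- z i) ^ j) * esym n (m - j) z\<bar> \<le> y * y ^ m"
        unfolding abs_mult using IH[of "m - j"] y by (intro mult_mono) auto
    qed
    also have "\<dots> = real (Suc m) * y ^ Suc m" by simp
    finally have "real (Suc m) * \<bar>esym n (Suc m) z\<bar> \<le> real (Suc m) * y ^ Suc m"
      by (simp add: abs_mult)
    then show ?thesis unfolding Suc y_def[symmetric] by (simp only: mult_le_cancel_left_pos of_nat_0_less_iff zero_less_Suc)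
  qed
qed

text \<open>
  In Newton's identity the term with the first power sum \<open>L\<close> reproduces the recursion of
  \<open>L ^ k / k!\<close>, while the other terms are of lower degree in \<open>L\<close>.
\<close>

theorem esym_approx_power:
  assumes z: "(\<Sum>i<n. (z i)\<^sup>2) \<le> 1"
  shows "\<bar>esym n (Suc k) z - (\<Sum>i<n. z i) ^ Suc k / fact (Suc k)\<bar> \<le> (1 + \<bar>\<Sum>i<n. z i\<bar>) ^ k"
proof (induction k)
  case 0
  show ?case using newton_identity[of 0 n z] by (simp add: esym_0)
next
  case (Suc k)
  define L where "L = (\<Sum>i<n. z i)"
  define y where "y = 1 + \<bar>L\<bar>"
  have y: "1 \<le> y" "\<bar>L\<bar> \<le> y" by (simp_all add: y_def)
  define R where "R = (\<Sum>j=1..Suc k. (\<Sum>i<n. z i * (- z i) ^ j) * esym n (Suc k - j) z)"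
  have newton: "real (Suc (Suc k)) * esym n (Suc (Suc k)) z = L * esym n (Suc k) z + R"
    unfolding newton_identity R_def atMost_atLeast0 L_def by (subst sum.atLeast_Suc_atMost) auto
  have "\<bar>R\<bar> \<le> (\<Sum>j=1..Suc k. \<bar>(\<Sum>i<n. z i * (- z i) ^ j) * esym n (Suc k - j) z\<bar>)"
    unfolding R_def by (rule sum_abs)
  also have "\<dots> \<le> (\<Sum>j=1..Suc k. 1 * y ^ Suc k)"
  proof (rule sum_mono)
    fix j assume j: "j \<in> {1..Suc k}"
    have "\<bar>esym n (Suc k - j) z\<bar> \<le> y ^ (Suc k - j)"
      using abs_esym_le_power[OF z] by (simp add: y_def L_def)
    also have "\<dots> \<le> y ^ Suc k" using y by (intro power_increasing) auto
    finally show "\<bar>(\<Sum>i<n. z i * (- z i) ^ j) * esym n (Suc k - j) z\<bar> \<le> 1 * y ^ Suc k"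
      unfolding abs_mult using abs_higher_power_sum_le[OF z, of j] j by (intro mult_mono) auto
  qed
  finally have R: "\<bar>R\<bar> \<le> real (Suc k) * y ^ Suc k" by simp
  have "real (Suc (Suc k)) * (esym n (Suc (Suc k)) z - L ^ Suc (Suc k) / fact (Suc (Suc k)))
      = L * (esym n (Suc k) z - L ^ Suc k / fact (Suc k)) + R"
    using newton by (simp add: right_diff_distrib fact_Suc[of "Suc k"] del: fact_Suc of_nat_Suc)
  then have "real (Suc (Suc k)) * \<bar>esym n (Suc (Suc k)) z - L ^ Suc (Suc k) / fact (Suc (Suc k))\<bar>
      = \<bar>L * (esym n (Suc k) z - L ^ Suc k / fact (Suc k)) + R\<bar>"
    by (metis abs_mult abs_of_nat)
  also have "\<dots> \<le> \<bar>L\<bar> * \<bar>esym n (Suc k) z - L ^ Suc k / fact (Suc k)\<bar> + \<bar>R\<bar>"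
    by (metis abs_mult abs_triangle_ineq)
  also have "\<dots> \<le> y * y ^ k + real (Suc k) * y ^ Suc k"
    using Suc.IH y R by (intro add_mono mult_mono) (auto simp: L_def y_def)
  also have "\<dots> = real (Suc (Suc k)) * y ^ Suc k" by (simp add: algebra_simps)
  finally show ?case
    unfolding L_def[symmetric] y_def[symmetric]
    by (simp only: mult_le_cancel_left_pos of_nat_0_less_iff zero_less_Suc)
qed

lemma power_le_fact_mult_exp:
  assumes "0 \<le> (y :: real)"
  shows "y ^ k \<le> fact k * exp y"
proof -
  have "(\<lambda>n. y ^ n / fact n) sums exp y"
    using exp_converges[of y] by (simp add: divide_inverse mult.commute)
  then have "(\<Sum>n\<in>{k}. y ^ n / fact n) \<le> exp y"
    using assms sum_le_suminf[of "\<lambda>n. y ^ n / fact n" "{k}"] by (auto simp: sums_iff)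
  then show ?thesis by (simp add: field_simps)
qed

text \<open>
  The lower-order error is absorbed by half of the main term, up to a constant. Where \<open>L\<close> is negative,
  \<open>L ^ k\<close> may be as small as \<open>- |L| ^ k\<close>; the exponential pays for this through
  \<open>|L| ^ k \<le> k! * exp |L|\<close>.
\<close>

lemma esym_pointwise_lower_bound:
  assumes k: "1 \<le> k"
  obtains C where "0 \<le> C" "\<And>n z. (\<Sum>i<n. (z i)\<^sup>2) \<le> 1 \<Longrightarrow>
    \<bar>\<Sum>i<n. z i\<bar> ^ k / (2 * fact k) - C - 2 * exp (- (\<Sum>i<n. z i)) \<le> esym n k z"
proof -
  obtain m where m: "k = Suc m" using k by (cases k) auto
  \<comment> \<open>From \<open>Y\<close> on, one factor \<open>y\<close> outweighs the constant \<open>2 ^ m * (2 * fact k)\<close>.\<close>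
  define Y :: real where "Y = 2 ^ k * fact k"
  have Y: "1 \<le> Y" by (simp add: Y_def mult_ge1_I)
  define C where "C = (1 + Y) ^ m"
  have C: "0 \<le> C" using Y by (simp add: C_def)
  have low: "(1 + y) ^ m \<le> y ^ k / (2 * fact k) + C" if y: "0 \<le> y" for y :: real
  proof (cases "y \<le> Y")
    case True
    then have "(1 + y) ^ m \<le> C" unfolding C_def using y by (intro power_mono) auto
    moreover have "0 \<le> y ^ k / (2 * fact k)" using y by simp
    ultimately show ?thesis by linarith
  next
    case False
    with Y have y1: "1 \<le> y" by simp
    have "(1 + y) ^ m \<le> (2 * y) ^ m" using y1 by (intro power_mono) auto
    also have "\<dots> = 2 ^ m * y ^ m" by (rule power_mult_distrib)
    also have "\<dots> = Y * y ^ m / (2 * fact k)" by (simp add: Y_def m del: fact_Suc)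
    also have "\<dots> \<le> y * y ^ m / (2 * fact k)"
      using False y by (intro divide_right_mono mult_right_mono) auto
    finally show ?thesis using C by (simp add: m del: fact_Suc)
  qed
  show ?thesis
  proof (rule that[OF C])
    fix n :: nat and z :: "nat \<Rightarrow> real" assume z: "(\<Sum>i<n. (z i)\<^sup>2) \<le> 1"
    define L where "L = (\<Sum>i<n. z i)"
    have "\<bar>L\<bar> ^ k - 2 * (fact k * exp (- L)) \<le> L ^ k"
    proof (cases "0 \<le> L")
      case False
      have "\<bar>L\<bar> ^ k \<le> fact k * exp \<bar>L\<bar>" by (rule power_le_fact_mult_exp) simp
      moreover have "- (\<bar>L\<bar> ^ k) \<le> L ^ k" by (metis abs_le_D2 minus_le_iff order_refl power_abs)
      ultimately show ?thesis using False by (simp add: abs_if)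
    qed (simp add: abs_if)
    then have "(\<bar>L\<bar> ^ k - 2 * (fact k * exp (- L))) / fact k \<le> L ^ k / fact k"
      by (intro divide_right_mono) auto
    then have "\<bar>L\<bar> ^ k / fact k - 2 * exp (- L) \<le> L ^ k / fact k"
      by (simp add: diff_divide_distrib)
    moreover have "L ^ k / fact k - (1 + \<bar>L\<bar>) ^ m \<le> esym n k z"
      using esym_approx_power[OF z, of m] unfolding m[symmetric] L_def[symmetric] by linarith
    moreover have "(1 + \<bar>L\<bar>) ^ m \<le> \<bar>L\<bar> ^ k / (2 * fact k) + C" by (rule low) simp
    moreover have "\<bar>L\<bar> ^ k / fact k = 2 * (\<bar>L\<bar> ^ k / (2 * fact k))" by simp
    ultimately show "\<bar>\<Sum>i<n. z i\<bar> ^ k / (2 * fact k) - C - 2 * exp (- (\<Sum>i<n. z i)) \<le> esym n k z"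
      unfolding L_def[symmetric] by linarith
  qed
qed

lemma power_ge_tangent:
  assumes "0 \<le> y" "0 \<le> (s :: real)"
  shows "s ^ Suc m + real (Suc m) * s ^ m * (y - s) \<le> y ^ Suc m"
proof (induction m)
  case (Suc m)
  have "s ^ Suc (Suc m) + real (Suc (Suc m)) * s ^ Suc m * (y - s)
      = y * (s ^ Suc m + real (Suc m) * s ^ m * (y - s)) - real (Suc m) * s ^ m * (y - s)\<^sup>2"
    by (simp add: algebra_simps power2_eq_square)
  also have "\<dots> \<le> y * (s ^ Suc m + real (Suc m) * s ^ m * (y - s))"
    using assms by simp
  also have "\<dots> \<le> y * y ^ Suc m"
    using Suc assms by (intro mult_left_mono) auto
  finally show ?case by simp
qed simp

section \<open>Influences and monotonicity\<close>

text \<open>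
  Averaging over a coordinate first: since flipping it preserves the uniform measure, nonnegativity
  has to be checked only for sums over the pairs \<open>x\<close>, \<open>flip i x\<close>.
\<close>

lemma cube_expectation_flip_sum_nonneg:
  assumes i: "i < n" and h: "\<And>x. x \<in> cube n \<Longrightarrow> 0 \<le> h x + h (flip i x)"
  shows "0 \<le> cube_expectation n h"
proof -
  have "0 \<le> cube_expectation n (\<lambda>x. h x + h (flip i x))"
    using h by (rule cube_expectation_nonneg)
  then show ?thesis
    using cube_expectation_flip[OF i, of h] by (simp add: cube_expectation_add)
qed

lemma influence_eq_expectation:
  "influence n f i = cube_expectation n (\<lambda>x. of_bool (f x \<noteq> f (flip i x)))"
proof -
  have "influence n f i = card (cube n \<inter> {x. f x \<noteq> f (flip i x)}) / 2 ^ n"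
    unfolding influence_def cube_unif_def
    by (subst measure_pmf_of_set) (simp_all add: finite_cube cube_nonempty card_cube)
  then show ?thesis
    by (simp add: cube_expectation_eq_sum finite_cube sum.If_cases of_bool_def Collect_conj_eq)
qed

text \<open>
  Summed over a pair \<open>x\<close>, \<open>flip i x\<close>, the values of \<open>f x * x i\<close> cancel unless \<open>f\<close> changes along this edge.
\<close>

lemma degree_one_coeff_le_influence:
  assumes i: "i < n" and f: "\<And>x. x \<in> cube n \<Longrightarrow> f x \<in> {0, 1}"
  shows "\<bar>cube_expectation n (\<lambda>x. f x * x i)\<bar> \<le> influence n f i / 2"
proof -
  let ?I = "\<lambda>x. of_bool (f x \<noteq> f (flip i x)) / 2 :: real"
  have half: "cube_expectation n ?I = influence n f i / 2"
    using cube_expectation_cmult[of n "1 / 2"] by (simp add: influence_eq_expectation)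
  have bound: "\<bar>f x * x i + f (flip i x) * flip i x i\<bar> \<le> ?I x + ?I (flip i x)" if x: "x \<in> cube n" for x
    using cube_coord[OF x i] f[OF x] f[OF flip_in_cube[OF i x]] by (auto simp: flip_flip flip_def)
  have "0 \<le> cube_expectation n (\<lambda>x. ?I x - f x * x i)"
  proof (rule cube_expectation_flip_sum_nonneg[OF i])
    fix x assume "x \<in> cube n"
    from abs_le_D1[OF bound[OF this]]
    show "0 \<le> ?I x - f x * x i + (?I (flip i x) - f (flip i x) * flip i x i)" by linarith
  qed
  moreover have "0 \<le> cube_expectation n (\<lambda>x. ?I x + f x * x i)"
  proof (rule cube_expectation_flip_sum_nonneg[OF i])
    fix x assume "x \<in> cube n"
    from abs_le_D2[OF bound[OF this]]
    show "0 \<le> ?I x + f x * x i + (?I (flip i x) + f (flip i x) * flip i x i)" by linarith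
  qed
  ultimately show ?thesis
    unfolding cube_expectation_diff cube_expectation_add half by linarith
qed

lemma cosh_le_exp_square:
  assumes "\<bar>b\<bar> \<le> (1 :: real)"
  shows "cosh b \<le> exp (b\<^sup>2)"
proof -
  define v where "v = \<bar>b\<bar>"
  have v: "0 \<le> v" "v \<le> 1" using assms by (auto simp: v_def)
  have "exp (- v) \<le> 1 - v + v\<^sup>2"
  proof -
    have "1 \<le> (1 + v) * (1 - v + v\<^sup>2)"
      using v by (simp add: algebra_simps power2_eq_square)
    also have "\<dots> \<le> exp v * (1 - v + v\<^sup>2)"
      using v exp_ge_add_one_self[of v] by (intro mult_right_mono) auto
    finally show ?thesis by (simp add: exp_minus field_simps)
  qed
  moreover have "exp v \<le> 1 + v + v\<^sup>2" using exp_bound[OF v] .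
  ultimately have "cosh v \<le> 1 + v\<^sup>2" by (simp add: cosh_def)
  also have "\<dots> \<le> exp (v\<^sup>2)" by (rule exp_ge_add_one_self)
  finally show ?thesis by (simp add: v_def)
qed

text \<open>
  A correlation inequality of Harris type: a function that increases in the direction of \<open>b\<close> is
  negatively correlated with \<open>exp (- L)\<close>. The product form of the exponential allows the
  coordinates to be removed one at a time. In \<open>exp (- b * x) = cosh b - x * sinh b\<close> the odd part contributes with a
  favourable sign by monotonicity.
\<close>

lemma monotone_exp_moment:
  assumes mono: "\<And>i x. i < n \<Longrightarrow> x \<in> cube n \<Longrightarrow> 0 \<le> b i * x i * (f x - f (flip i x))"
    and m: "m \<le> n"
  shows "cube_expectation n (\<lambda>x. f x * exp (- (\<Sum>i<m. b i * x i)))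
           \<le> (\<Prod>i<m. cosh (b i)) * cube_expectation n f"
  using m
proof (induction m)
  case 0
  show ?case by simp
next
  case (Suc m)
  then have m: "m < n" by simp
  let ?g = "\<lambda>x. exp (- (\<Sum>i<m. b i * x i))"
  have g_flip: "?g (flip m x) = ?g x" for x
    by (simp add: flip_def)
  have split: "f x * exp (- (\<Sum>i<Suc m. b i * x i))
      = cosh (b m) * (f x * ?g x) - sinh (b m) * x m * f x * ?g x" if x: "x \<in> cube n" for x
  proof -
    have e1: "exp (- (b m * x m)) = cosh (b m) - sinh (b m) * x m"
      using cube_coord[OF x m] cosh_minus_sinh[of "b m"] cosh_plus_sinh[of "b m"] by auto
    have e2: "exp (- (\<Sum>i<Suc m. b i * x i)) = ?g x * exp (- (b m * x m))"
      by (simp add: exp_add[symmetric])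
    show ?thesis unfolding e2 e1 by (simp add: algebra_simps)
  qed
  have "0 \<le> cube_expectation n (\<lambda>x. sinh (b m) * x m * f x * ?g x)"
  proof (rule cube_expectation_flip_sum_nonneg[OF m])
    fix x assume x: "x \<in> cube n"
    have "0 \<le> sinh (b m) * (x m * (f x - f (flip m x)))"
      using mono[OF m x] by (cases "b m" "0 :: real" rule: linorder_cases)
        (auto simp: zero_le_mult_iff mult.assoc)
    then have "0 \<le> sinh (b m) * (x m * (f x - f (flip m x))) * ?g x" by simp
    moreover have "flip m x m = - x m" by (simp add: flip_def)
    ultimately show "0 \<le> sinh (b m) * x m * f x * ?g x
        + sinh (b m) * flip m x m * f (flip m x) * ?g (flip m x)"
      unfolding g_flip by (simp add: algebra_simps)
  qed
  moreover have "cube_expectation n (\<lambda>x. f x * exp (- (\<Sum>i<Suc m. b i * x i)))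
      = cosh (b m) * cube_expectation n (\<lambda>x. f x * ?g x)
        - cube_expectation n (\<lambda>x. sinh (b m) * x m * f x * ?g x)"
    unfolding cube_expectation_cmult[symmetric] cube_expectation_diff[symmetric]
    by (rule cube_expectation_cong) (rule split)
  ultimately have "cube_expectation n (\<lambda>x. f x * exp (- (\<Sum>i<Suc m. b i * x i)))
      \<le> cosh (b m) * cube_expectation n (\<lambda>x. f x * ?g x)" by linarith
  also have "\<dots> \<le> cosh (b m) * ((\<Prod>i<m. cosh (b i)) * cube_expectation n f)"
    using Suc by (intro mult_left_mono) auto
  finally show ?case by (simp add: mult_ac)
qed

lemma halfspace_monotone:
  assumes f: "\<And>x. x \<in> cube n \<Longrightarrow> f x = of_bool ((\<Sum>i<n. a i * x i) > t)"
    and i: "i < n" and x: "x \<in> cube n"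
  shows "(0 :: real) \<le> a i * x i * (f x - f (flip i x))"
proof -
  have "(\<Sum>j<n. a j * flip i x j) = (\<Sum>j<n. a j * x j - (if j = i then 2 * (a i * x i) else 0))"
    by (intro sum.cong) (auto simp: flip_def)
  also have "\<dots> = (\<Sum>j<n. a j * x j) - 2 * (a i * x i)"
    using i by (simp add: sum_subtractf)
  finally have "(\<Sum>j<n. a j * flip i x j) = (\<Sum>j<n. a j * x j) - 2 * (a i * x i)" .
  then show ?thesis
    using f[OF x] f[OF flip_in_cube[OF i x]] by (auto simp: of_bool_def)
qed

section \<open>Degree one: a small linear form correlated with a halfspace\<close>

text \<open>
  If the threshold were lower, \<open>f\<close> would be \<open>1\<close> wherever the linear form exceeds \<open>\<Lambda> / 4\<close>. That event has
  probability at least \<open>exp (- 3 * \<Lambda> / 4) / 2\<close>, which is more than \<open>p = exp (- \<Lambda>)\<close>.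
\<close>

lemma halfspace_threshold_lower_bound:
  fixes \<alpha> :: "nat \<Rightarrow> real" and n :: nat
  assumes f: "\<And>x. x \<in> cube n \<Longrightarrow> f x = of_bool ((\<Sum>i<n. \<alpha> i * x i) > \<theta>)"
    and p: "0 < p" "p = cube_expectation n f"
    and \<Lambda>: "16 \<le> ln (1 / p)"
    and T: "(\<Sum>i<n. \<alpha> i * tanh (\<alpha> i)) = ln (1 / p) / 2"
  shows "ln (1 / p) / 4 \<le> \<theta>"
proof (rule ccontr)
  assume "\<not> ?thesis"
  then have \<theta>: "\<theta> < ln (1 / p) / 2 / 2" by simp
  let ?\<Lambda> = "ln (1 / p)"
  have "exp (- (3 / 2) * (?\<Lambda> / 2)) / 2
      \<le> cube_expectation n (\<lambda>x. of_bool (?\<Lambda> / 2 / 2 \<le> (\<Sum>i<n. \<alpha> i * x i)))"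
    using linear_tail_lower_bound[where n = n and \<alpha> = \<alpha>] \<Lambda> unfolding T by simp
  also have "\<dots> \<le> cube_expectation n f"
    using \<theta> f by (intro cube_expectation_mono) auto
  also note p(2)[symmetric]
  also have "p = exp (- (3 / 2) * (?\<Lambda> / 2)) * exp (- ?\<Lambda> / 4)"
    using p by (simp add: exp_add[symmetric] ln_div)
  finally have "1 / 2 \<le> exp (- ?\<Lambda> / 4)" by simp
  moreover have "5 \<le> exp (?\<Lambda> / 4)" using \<Lambda> exp_ge_add_one_self[of "?\<Lambda> / 4"] by linarith
  then have "exp (- ?\<Lambda> / 4) \<le> 1 / 5" by (simp add: exp_minus field_simps)
  ultimately show False by linarith
qed

text \<open>
  The form \<open>\<Sum>i<n. \<alpha> i * x i\<close> exceeds \<open>\<theta> \<ge> T / 2\<close> wherever \<open>f = 1\<close>, so its correlation with \<open>f\<close> is at least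
  \<open>p * T / 2\<close>. A coordinate with \<open>|\<alpha> i| > 1\<close> has \<open>|\<alpha> i| \<le> 2 * \<alpha> i * tanh (\<alpha> i)\<close>; small
  influences keep the total contribution of such coordinates at or below \<open>p * T / 4\<close>. On the other
  coordinates \<open>(\<alpha> i)\<^sup>2\<close> is at most \<open>2 * \<alpha> i * tanh (\<alpha> i)\<close>.
\<close>

lemma small_coordinates_correlate:
  fixes \<alpha> :: "nat \<Rightarrow> real" and n :: nat
  defines "T \<equiv> \<Sum>i<n. \<alpha> i * tanh (\<alpha> i)"
    and "b \<equiv> \<lambda>i. if \<bar>\<alpha> i\<bar> \<le> 1 then \<alpha> i else 0"
  assumes f: "\<And>x. x \<in> cube n \<Longrightarrow> f x = of_bool ((\<Sum>i<n. \<alpha> i * x i) > \<theta>)"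
    and T: "0 \<le> T" "T / 2 \<le> \<theta>"
    and inf: "\<And>i. i < n \<Longrightarrow> influence n f i \<le> cube_expectation n f / 4"
  shows "cube_expectation n f * (T / 4) \<le> cube_expectation n (\<lambda>x. f x * (\<Sum>i<n. b i * x i))"
    and "(\<Sum>i<n. (b i)\<^sup>2) \<le> 2 * T"
proof -
  let ?p = "cube_expectation n f"
  let ?m = "\<lambda>i. cube_expectation n (\<lambda>x. f x * x i)"
  have f01: "f x \<in> {0, 1}" if "x \<in> cube n" for x using f[OF that] by simp
  have p: "0 \<le> ?p" using f by (intro cube_expectation_nonneg) auto
  have lin: "cube_expectation n (\<lambda>x. f x * (\<Sum>i<n. c i * x i)) = (\<Sum>i<n. c i * ?m i)" for c
    unfolding sum_distrib_left
    by (simp only: cube_expectation_sum mult.left_commute[of _ "c _"] cube_expectation_cmult)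
  have "?p * (T / 2) = cube_expectation n (\<lambda>x. T / 2 * f x)"
    unfolding cube_expectation_cmult by (simp only: mult.commute)
  also have "\<dots> \<le> cube_expectation n (\<lambda>x. f x * (\<Sum>i<n. \<alpha> i * x i))"
    using T f by (intro cube_expectation_mono) auto
  also have "\<dots> = (\<Sum>i<n. \<alpha> i * ?m i)" by (rule lin)
  also have "\<dots> \<le> (\<Sum>i<n. b i * ?m i + ?p / 4 * (\<alpha> i * tanh (\<alpha> i)))"
  proof (rule sum_mono)
    fix i assume "i \<in> {..<n}"
    then have i: "i < n" by simp
    show "\<alpha> i * ?m i \<le> b i * ?m i + ?p / 4 * (\<alpha> i * tanh (\<alpha> i))"
    proof (cases "\<bar>\<alpha> i\<bar> \<le> 1")
      case True
      then show ?thesis using p mult_tanh_nonneg[of "\<alpha> i"] by (simp add: b_def)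
    next
      case False
      have "\<bar>?m i\<bar> \<le> influence n f i / 2" using i f01 by (rule degree_one_coeff_le_influence)
      with inf[OF i] have m: "\<bar>?m i\<bar> \<le> ?p / 8" by linarith
      have "\<alpha> i * ?m i \<le> \<bar>\<alpha> i\<bar> * \<bar>?m i\<bar>" by (metis abs_ge_self abs_mult)
      also have "\<dots> \<le> (2 * (\<alpha> i * tanh (\<alpha> i))) * (?p / 8)"
        using False m abs_le_mult_tanh[of "\<alpha> i"]
        by (intro mult_mono) auto
      finally show ?thesis using False by (simp add: b_def mult_ac)
    qed
  qed
  also have "\<dots> = (\<Sum>i<n. b i * ?m i) + ?p / 4 * T"
    by (simp add: sum.distrib T_def sum_distrib_left)
  finally show "?p * (T / 4) \<le> cube_expectation n (\<lambda>x. f x * (\<Sum>i<n. b i * x i))"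
    unfolding lin by (simp add: algebra_simps)
  have "(\<Sum>i<n. (b i)\<^sup>2) \<le> (\<Sum>i<n. 2 * (\<alpha> i * tanh (\<alpha> i)))"
    using square_le_mult_tanh mult_tanh_nonneg by (intro sum_mono) (auto simp: b_def)
  then show "(\<Sum>i<n. (b i)\<^sup>2) \<le> 2 * T" by (simp add: T_def sum_distrib_left)
qed

lemma halfspace_correlates_with_small_linear_form:
  assumes f: "\<And>x. x \<in> cube n \<Longrightarrow> f x = of_bool ((\<Sum>i<n. a i * x i) > t)"
    and p: "0 < p" "p = cube_expectation n f"
    and \<Lambda>: "16 \<le> ln (1 / p)"
    and inf: "\<And>i. i < n \<Longrightarrow> influence n f i \<le> p / 4"
  obtains b :: "nat \<Rightarrow> real" where "(\<Sum>i<n. (b i)\<^sup>2) = 1"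
    "\<And>i x. i < n \<Longrightarrow> x \<in> cube n \<Longrightarrow> 0 \<le> b i * x i * (f x - f (flip i x))"
    "p * (sqrt (ln (1 / p)) / 8) \<le> cube_expectation n (\<lambda>x. f x * (\<Sum>i<n. b i * x i))"
proof -
  define T where "T = ln (1 / p) / 2"
  have T: "8 \<le> T" using \<Lambda> by (simp add: T_def)
  \<comment> \<open>Otherwise \<open>f\<close> would be constant and \<open>p\<close> would be \<open>0\<close> or \<open>1\<close>.\<close>
  have "\<exists>i<n. a i \<noteq> 0"
  proof (rule ccontr)
    assume "\<not> ?thesis"
    then have "f x = of_bool (0 > t)" if "x \<in> cube n" for x using f[OF that] by simp
    then have "p = of_bool (0 > t)"
      unfolding p(2) using cube_expectation_cong[of n f] by (simp add: cube_expectation_const)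
    with p \<Lambda> show False by (auto split: if_splits simp: of_bool_def)
  qed
  then obtain s where s: "0 < s" "(\<Sum>i<n. s * a i * tanh (s * a i)) = T"
    using exists_tilt_scale[of _ n a T] T by auto
  define \<alpha> where "\<alpha> = (\<lambda>i. s * a i)"
  have T\<alpha>: "(\<Sum>i<n. \<alpha> i * tanh (\<alpha> i)) = T" using s by (simp add: \<alpha>_def)
  have f\<alpha>: "f x = of_bool ((\<Sum>i<n. \<alpha> i * x i) > s * t)" if "x \<in> cube n" for x
    using f[OF that] s(1) by (simp add: \<alpha>_def mult.assoc sum_distrib_left[symmetric])
  have thr: "T / 2 \<le> s * t"
    using halfspace_threshold_lower_bound[OF f\<alpha> p \<Lambda>] T\<alpha> by (simp add: T_def)
  define c where "c = (\<lambda>i. if \<bar>\<alpha> i\<bar> \<le> 1 then \<alpha> i else 0)"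
  have corr: "p * (T / 4) \<le> cube_expectation n (\<lambda>x. f x * (\<Sum>i<n. c i * x i))"
    and norm: "(\<Sum>i<n. (c i)\<^sup>2) \<le> 2 * T"
    using small_coordinates_correlate[OF f\<alpha>] T thr inf unfolding T\<alpha> c_def p(2) by auto
  define N where "N = sqrt (\<Sum>i<n. (c i)\<^sup>2)"
  have N2: "N\<^sup>2 = (\<Sum>i<n. (c i)\<^sup>2)" by (simp add: N_def sum_nonneg)
  have "N \<noteq> 0"
  proof
    assume "N = 0"
    then have "c i = 0" if "i < n" for i
      using N2 that by (simp add: sum_nonneg_eq_0_iff)
    then have "cube_expectation n (\<lambda>x. f x * (\<Sum>i<n. c i * x i)) = 0"
      by (simp add: cube_expectation_const)
    with corr p T show False by (simp add: mult_le_0_iff)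
  qed
  then have N: "0 < N" by (simp add: N_def sum_nonneg less_le)
  have NT: "N * (sqrt (2 * T) / 8) \<le> T / 4"
  proof -
    have "N \<le> sqrt (2 * T)" unfolding N_def using norm by simp
    then have "N * (sqrt (2 * T) / 8) \<le> sqrt (2 * T) * (sqrt (2 * T) / 8)"
      using T by (intro mult_right_mono) auto
    also have "\<dots> = T / 4" using T by (simp add: real_sqrt_mult_self)
    finally show ?thesis .
  qed
  show ?thesis
  proof (rule that[of "\<lambda>i. c i / N"])
    show "(\<Sum>i<n. (c i / N)\<^sup>2) = 1"
      unfolding power_divide sum_divide_distrib[symmetric] N2[symmetric] using N by simp
  next
    fix i x assume ix: "i < n" "x \<in> cube n"
    have "0 \<le> \<alpha> i * x i * (f x - f (flip i x))"
      by (rule halfspace_monotone[OF f\<alpha> ix])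
    then have "0 \<le> c i * x i * (f x - f (flip i x)) / N"
      using N by (intro divide_nonneg_pos) (auto simp: c_def)
    then show "0 \<le> c i / N * x i * (f x - f (flip i x))" by simp
  next
    have "N * (p * (sqrt (2 * T) / 8)) \<le> p * (T / 4)"
      using NT p by (simp add: mult.left_commute mult_left_mono)
    also note corr
    also have "cube_expectation n (\<lambda>x. f x * (\<Sum>i<n. c i * x i))
        = N * cube_expectation n (\<lambda>x. f x * (\<Sum>i<n. c i / N * x i))"
      unfolding cube_expectation_cmult[symmetric] using N
      by (intro cube_expectation_cong) (simp add: sum_distrib_left)
    finally have "p * (sqrt (2 * T) / 8) \<le> cube_expectation n (\<lambda>x. f x * (\<Sum>i<n. c i / N * x i))"
      using N by simp
    then show "p * (sqrt (ln (1 / p)) / 8) \<le> cube_expectation n (\<lambda>x. f x * (\<Sum>i<n. c i / N * x i))"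
      by (simp add: T_def)
  qed
qed

section \<open>From degree one to degree k\<close>

text \<open>
  Cauchy-Schwarz on level \<open>k\<close>. The squared norm of the test polynomial is the elementary symmetric
  polynomial of the numbers \<open>(b i)\<^sup>2\<close>, which is bounded by \<open>abs_esym_le_power\<close> again.
\<close>

lemma esym_expectation_le_weight:
  assumes b: "(\<Sum>i<n. (b i)\<^sup>2) \<le> 1"
  shows "(cube_expectation n (\<lambda>x. f x * esym n k (\<lambda>i. b i * x i)))\<^sup>2 \<le> 2 ^ k * fourier_weight k n f"
proof -
  let ?K = "{S. S \<subseteq> {..<n} \<and> card S = k}"
  have "f x * esym n k (\<lambda>i. b i * x i)
      = (\<Sum>S\<in>?K. (\<Prod>i\<in>S. b i) * (f x * (\<Prod>i\<in>S. x i)))" for x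
    by (simp add: esym_def sum_distrib_left prod.distrib mult_ac)
  then have "cube_expectation n (\<lambda>x. f x * esym n k (\<lambda>i. b i * x i))
      = (\<Sum>S\<in>?K. (\<Prod>i\<in>S. b i) * fourier_coeff n f S)"
    by (simp add: cube_expectation_sum cube_expectation_cmult fourier_coeff_def)
  then have "(cube_expectation n (\<lambda>x. f x * esym n k (\<lambda>i. b i * x i)))\<^sup>2
      \<le> (\<Sum>S\<in>?K. (\<Prod>i\<in>S. b i)\<^sup>2) * fourier_weight k n f"
    using Cauchy_Schwarz_ineq_sum[of "\<lambda>S. \<Prod>i\<in>S. b i" "fourier_coeff n f" ?K]
    by (simp add: fourier_weight_def)
  also have "\<dots> \<le> 2 ^ k * fourier_weight k n f"
  proof (rule mult_right_mono)
    have le: "(b i)\<^sup>2 \<le> 1" if "i < n" for i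
      using b that member_le_sum[of i "{..<n}" "\<lambda>i. (b i)\<^sup>2"] by auto
    have "(\<Sum>i<n. ((b i)\<^sup>2)\<^sup>2) \<le> (\<Sum>i<n. (b i)\<^sup>2)"
    proof (rule sum_mono)
      fix i assume "i \<in> {..<n}"
      then have "(b i)\<^sup>2 * (b i)\<^sup>2 \<le> (b i)\<^sup>2 * 1" using le by (intro mult_left_mono) auto
      then show "((b i)\<^sup>2)\<^sup>2 \<le> (b i)\<^sup>2" by (simp only: power2_eq_square[of "(b i)\<^sup>2"] mult_1_right)
    qed
    with b have "\<bar>esym n k (\<lambda>i. (b i)\<^sup>2)\<bar> \<le> (1 + \<bar>\<Sum>i<n. (b i)\<^sup>2\<bar>) ^ k"
      by (intro abs_esym_le_power) auto
    also have "\<dots> \<le> 2 ^ k"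
      using b by (intro power_mono) (auto simp: sum_nonneg)
    finally show "(\<Sum>S\<in>?K. (\<Prod>i\<in>S. b i)\<^sup>2) \<le> 2 ^ k"
      by (simp add: esym_def prod_power_distrib)
    show "0 \<le> fourier_weight k n f" by (simp add: fourier_weight_def sum_nonneg)
  qed
  finally show ?thesis .
qed

text \<open>
  In \<open>esym_pointwise_lower_bound\<close>, \<open>|L| ^ k\<close> is replaced by its tangent at \<open>s\<close>, a form of Jensen's inequality that only
  involves \<open>E[f * L]\<close>. The slope \<open>c\<close> of the tangent is kept as a separate constant, so that the
  pointwise estimate is linear in \<open>f\<close>, \<open>f * L\<close> and \<open>f * exp (- L)\<close> and can be integrated.
\<close>

lemma esym_correlation_of_linear_correlation:
  assumes k: "1 \<le> k"
  obtains C where "0 \<le> C" "\<And>n f b s. (\<And>x. x \<in> cube n \<Longrightarrow> 0 \<le> f x) \<Longrightarrow> (\<Sum>i<n. (b i)\<^sup>2) = 1 \<Longrightarrow>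
    (\<And>i x. i < n \<Longrightarrow> x \<in> cube n \<Longrightarrow> 0 \<le> b i * x i * (f x - f (flip i x))) \<Longrightarrow>
    0 \<le> s \<Longrightarrow> cube_expectation n f * s \<le> cube_expectation n (\<lambda>x. f x * (\<Sum>i<n. b i * x i)) \<Longrightarrow>
    cube_expectation n f * (s ^ k / (2 * fact k) - C)
      \<le> cube_expectation n (\<lambda>x. f x * esym n k (\<lambda>i. b i * x i))"
proof -
  obtain C where C: "0 \<le> C" and low: "\<And>n z. (\<Sum>i<n. (z i)\<^sup>2) \<le> 1 \<Longrightarrow>
    \<bar>\<Sum>i<n. z i\<bar> ^ k / (2 * fact k) - C - 2 * exp (- (\<Sum>i<n. z i)) \<le> esym n k z"
    using esym_pointwise_lower_bound[OF k] by blast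
  obtain m where m: "k = Suc m" using k by (cases k) auto
  show ?thesis
  proof (rule that[of "C + 6"])
    show "0 \<le> C + 6" using C by simp
  next
    fix n :: nat and f :: "(nat \<Rightarrow> real) \<Rightarrow> real" and b :: "nat \<Rightarrow> real" and s :: real
    assume f: "\<And>x. x \<in> cube n \<Longrightarrow> 0 \<le> f x" and b: "(\<Sum>i<n. (b i)\<^sup>2) = 1"
      and mono: "\<And>i x. i < n \<Longrightarrow> x \<in> cube n \<Longrightarrow> 0 \<le> b i * x i * (f x - f (flip i x))"
      and s: "0 \<le> s"
      and corr: "cube_expectation n f * s \<le> cube_expectation n (\<lambda>x. f x * (\<Sum>i<n. b i * x i))"
    let ?E = "cube_expectation n" and ?L = "\<lambda>x. \<Sum>i<n. b i * x i"
    define p where "p = ?E f"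
    have p: "0 \<le> p" unfolding p_def using f by (rule cube_expectation_nonneg)
    define c where "c = real k * s ^ m / (2 * fact k)"
    have c: "0 \<le> c" using s by (simp add: c_def)
    have point: "(s ^ k / (2 * fact k) - C - c * s) * f x + c * (f x * ?L x) - 2 * (f x * exp (- ?L x))
        \<le> f x * esym n k (\<lambda>i. b i * x i)" if x: "x \<in> cube n" for x
    proof -
      have "(x i)\<^sup>2 = 1" if "i < n" for i using cube_coord[OF x that] by auto
      then have "(\<Sum>i<n. (b i * x i)\<^sup>2) \<le> 1" using b by (simp add: power_mult_distrib)
      note low[OF this]
      moreover have "s ^ k / (2 * fact k) + c * (?L x - s) \<le> \<bar>?L x\<bar> ^ k / (2 * fact k)"
      proof -
        have "s ^ k + real k * s ^ m * (\<bar>?L x\<bar> - s) \<le> \<bar>?L x\<bar> ^ k"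
          unfolding m using s by (intro power_ge_tangent) auto
        then have "(s ^ k + real k * s ^ m * (\<bar>?L x\<bar> - s)) / (2 * fact k) \<le> \<bar>?L x\<bar> ^ k / (2 * fact k)"
          by (intro divide_right_mono) auto
        moreover have "c * (?L x - s) \<le> c * (\<bar>?L x\<bar> - s)" using c by (intro mult_left_mono) auto
        ultimately show ?thesis by (simp add: c_def add_divide_distrib)
      qed
      ultimately have "s ^ k / (2 * fact k) - C + c * (?L x - s) - 2 * exp (- ?L x)
          \<le> esym n k (\<lambda>i. b i * x i)" by linarith
      then have "f x * (s ^ k / (2 * fact k) - C + c * (?L x - s) - 2 * exp (- ?L x))
          \<le> f x * esym n k (\<lambda>i. b i * x i)" using f[OF x] by (rule mult_left_mono)
      then show ?thesis by (simp add: algebra_simps)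
    qed
    have "?E (\<lambda>x. f x * exp (- ?L x)) \<le> (\<Prod>i<n. cosh (b i)) * p"
      unfolding p_def using mono by (rule monotone_exp_moment) simp_all
    also have "\<dots> \<le> (\<Prod>i<n. exp ((b i)\<^sup>2)) * p"
    proof (intro mult_right_mono prod_mono conjI cosh_le_exp_square p)
      fix i assume "i \<in> {..<n}"
      then have "(b i)\<^sup>2 \<le> 1" unfolding b[symmetric] by (intro member_le_sum) auto
      then show "\<bar>b i\<bar> \<le> 1" by (simp add: abs_square_le_1)
    qed simp
    also have "\<dots> = exp 1 * p" by (simp add: exp_sum[symmetric] b)
    also have "\<dots> \<le> 3 * p" using exp_le p by (intro mult_right_mono) auto
    finally have tail: "?E (\<lambda>x. f x * exp (- ?L x)) \<le> 3 * p" .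
    have "p * (s ^ k / (2 * fact k) - (C + 6))
        = (s ^ k / (2 * fact k) - C - c * s) * p + c * (p * s) - 2 * (3 * p)"
      by (simp add: algebra_simps)
    also have "\<dots> \<le> (s ^ k / (2 * fact k) - C - c * s) * p + c * ?E (\<lambda>x. f x * ?L x)
        - 2 * ?E (\<lambda>x. f x * exp (- ?L x))"
      using corr tail c unfolding p_def by (intro diff_mono add_left_mono mult_left_mono) auto
    also have "\<dots> = ?E (\<lambda>x. (s ^ k / (2 * fact k) - C - c * s) * f x + c * (f x * ?L x)
        - 2 * (f x * exp (- ?L x)))"
      by (simp only: cube_expectation_diff cube_expectation_add cube_expectation_cmult p_def)
    also have "\<dots> \<le> ?E (\<lambda>x. f x * esym n k (\<lambda>i. b i * x i))"
      by (rule cube_expectation_mono) (rule point)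
    finally show "?E f * (s ^ k / (2 * fact k) - (C + 6)) \<le> ?E (\<lambda>x. f x * esym n k (\<lambda>i. b i * x i))"
      unfolding p_def .
  qed
qed

theorem theorem1p3:
  fixes k :: nat
  assumes "k \<ge> 1"
  shows "\<exists>c1 c2 c3 c4 :: real. c1 > 0 \<and> c2 > 0 \<and> c3 > 0 \<and> c4 > 0 \<and>
    (\<forall>(n :: nat) (f :: (nat \<Rightarrow> real) \<Rightarrow> real).
      n \<ge> 1 \<longrightarrow> halfspace n f \<longrightarrow>
      cube_expectation n f \<le> c1 \<longrightarrow>
      max_influence n f \<le> c4 * cube_expectation n f \<longrightarrow>
      c2 * level_bound k (cube_expectation n f) \<le> fourier_weight k n f \<and>
      fourier_weight k n f \<le> c3 * level_bound k (cube_expectation n f))"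
proof -
  obtain C where C: "0 \<le> C" and moment: "\<And>n f b s. (\<And>x. x \<in> cube n \<Longrightarrow> 0 \<le> f x) \<Longrightarrow>
    (\<Sum>i<n. (b i)\<^sup>2) = 1 \<Longrightarrow>
    (\<And>i x. i < n \<Longrightarrow> x \<in> cube n \<Longrightarrow> 0 \<le> b i * x i * (f x - f (flip i x))) \<Longrightarrow>
    0 \<le> s \<Longrightarrow> cube_expectation n f * s \<le> cube_expectation n (\<lambda>x. f x * (\<Sum>i<n. b i * x i)) \<Longrightarrow>
    cube_expectation n f * (s ^ k / (2 * fact k) - C)
      \<le> cube_expectation n (\<lambda>x. f x * esym n k (\<lambda>i. b i * x i))"
    using esym_correlation_of_linear_correlation[OF assms] by blast
  \<comment> \<open>From \<open>s \<ge> K\<close> on, the constant \<open>C\<close> uses up at most half of \<open>s ^ k / (2 * fact k)\<close>. As \<open>s = sqrt \<Lambda> / 8\<close>,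
      this and \<open>\<Lambda> \<ge> 16\<close> are what the choice of \<open>c1\<close> guarantees.\<close>
  define K where "K = 1 + 4 * fact k * C"
  have K: "1 \<le> K" using C by (simp add: K_def)
  define c1 where "c1 = exp (- (16 + (8 * K)\<^sup>2))"
  define c2 :: real where "c2 = 1 / (2 ^ k * 64 ^ k * (4 * fact k)\<^sup>2)"
  have "1 \<le> 16 + (8 * K)\<^sup>2" using zero_le_power2[of "8 * K"] by linarith
  then have c1: "0 < c1" "c1 \<le> exp (-1)" unfolding c1_def exp_le_cancel_iff neg_le_iff_le by simp_all
  have c2: "0 < c2" by (simp add: c2_def)
  have main: "c2 * level_bound k (cube_expectation n f) \<le> fourier_weight k n f"
    if n: "n \<ge> 1" and hs: "halfspace n f" and small: "cube_expectation n f \<le> c1"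
      and inf: "max_influence n f \<le> 1 / 4 * cube_expectation n f" for n f
  proof -
    obtain a t where f: "\<And>x. x \<in> cube n \<Longrightarrow> f x = of_bool ((\<Sum>i<n. a i * x i) > t)"
      using hs unfolding halfspace_def by blast
    define p where "p = cube_expectation n f"
    have f0: "0 \<le> f x" if "x \<in> cube n" for x using f[OF that] by simp
    then have p0: "0 \<le> p" unfolding p_def by (rule cube_expectation_nonneg)
    show ?thesis
    proof (cases "p = 0")
      case True
      then show ?thesis by (simp add: p_def[symmetric] level_bound_0 fourier_weight_def sum_nonneg)
    next
      case False
      with p0 have p: "0 < p" by simp
      define \<Lambda> where "\<Lambda> = ln (1 / p)"
      have "ln p \<le> ln c1" using p c1 small p_def by (subst ln_le_cancel_iff) auto
      then have "16 + (8 * K)\<^sup>2 \<le> \<Lambda>" using p by (simp add: \<Lambda>_def ln_div c1_def)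
      moreover have "0 \<le> (8 * K)\<^sup>2" by simp
      ultimately have \<Lambda>: "16 \<le> \<Lambda>" "(8 * K)\<^sup>2 \<le> \<Lambda>" by linarith+
      define s where "s = sqrt \<Lambda> / 8"
      have "8 * K \<le> sqrt \<Lambda>" using \<Lambda> by (intro real_le_rsqrt)
      then have s: "K \<le> s" by (simp add: s_def)
      have inf_i: "influence n f i \<le> p / 4" if "i < n" for i
      proof -
        have "influence n f i \<le> max_influence n f"
          unfolding max_influence_def using that by (intro Max_ge) auto
        with inf show ?thesis by (simp add: p_def)
      qed
      obtain b where b: "(\<Sum>i<n. (b i)\<^sup>2) = 1"
        and mono: "\<And>i x. i < n \<Longrightarrow> x \<in> cube n \<Longrightarrow> 0 \<le> b i * x i * (f x - f (flip i x))"
        and corr: "p * s \<le> cube_expectation n (\<lambda>x. f x * (\<Sum>i<n. b i * x i))"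
        using halfspace_correlates_with_small_linear_form[OF f p p_def _ inf_i] \<Lambda>
        unfolding s_def \<Lambda>_def by blast
      have moment_f: "p * (s ^ k / (2 * fact k) - C)
          \<le> cube_expectation n (\<lambda>x. f x * esym n k (\<lambda>i. b i * x i))"
        using moment[OF f0 b mono _ corr[unfolded p_def]] s K by (simp add: p_def)
      have "s ^ k / (4 * fact k) \<le> s ^ k / (2 * fact k) - C"
      proof -
        have "s ^ 1 \<le> s ^ k" using s K assms by (intro power_increasing) auto
        with s have "4 * fact k * C \<le> s ^ k" by (simp add: K_def)
        then show ?thesis by (simp add: field_simps)
      qed
      then have "p * (s ^ k / (4 * fact k)) \<le> p * (s ^ k / (2 * fact k) - C)"
        using p by (intro mult_left_mono) auto
      with moment_f have "p * (s ^ k / (4 * fact k))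
          \<le> cube_expectation n (\<lambda>x. f x * esym n k (\<lambda>i. b i * x i))" by linarith
      then have "(p * (s ^ k / (4 * fact k)))\<^sup>2
          \<le> (cube_expectation n (\<lambda>x. f x * esym n k (\<lambda>i. b i * x i)))\<^sup>2"
        using p s K by (intro power_mono) auto
      also have "\<dots> \<le> 2 ^ k * fourier_weight k n f"
        using b by (intro esym_expectation_le_weight) simp
      finally have "(p * (s ^ k / (4 * fact k)))\<^sup>2 / 2 ^ k \<le> fourier_weight k n f"
        by (simp add: field_simps)
      also have "(p * (s ^ k / (4 * fact k)))\<^sup>2 / 2 ^ k = c2 * level_bound k p"
      proof -
        have "(s ^ k)\<^sup>2 = (s\<^sup>2) ^ k" by (simp add: power_mult[symmetric] mult.commute)
        also have "s\<^sup>2 = \<Lambda> / 64" using \<Lambda> by (simp add: s_def power_divide)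
        finally have "(s ^ k)\<^sup>2 = \<Lambda> ^ k / 64 ^ k" by (simp add: power_divide)
        then show ?thesis
          by (simp add: c2_def level_bound_def \<Lambda>_def[symmetric] power_mult_distrib power_divide)
      qed
      finally show ?thesis by (simp add: p_def)
    qed
  qed
  have upper: "fourier_weight k n f \<le> exp 2 * level_bound k (cube_expectation n f)"
    if "halfspace n f" "cube_expectation n f \<le> c1" for n f
  proof (rule level_inequality)
    show "f x \<in> {0, 1}" if "x \<in> cube n" for x
      using \<open>halfspace n f\<close> that unfolding halfspace_def by auto
    show "cube_expectation n f \<le> exp (-1)" using that c1 by linarith
  qed
  show ?thesis
    using c1 c2 main upper
    by (intro exI[of _ c1] exI[of _ c2] exI[of _ "exp 2"] exI[of _ "1 / 4"]) auto
qed

end
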